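(* Let $(\phi_h^1,\mu_h^{1/2})\in S_h\times S_h$ be the unique solution of the first-step problem and, for $1\le m\le M-1$, let $(\phi_h^{m+1},\mu_h^{m+1/2})\in S_h\times S_h$ be the unique solution of the multistep problem (both problems are written out in the context). Then for any $h,\tau>0$ and all $1\le\ell\le M-1$, $$F(\phi_h^{\ell+1},\phi_h^\ell)+\tau\varepsilon\sum_{m=1}^{\ell}\|\nabla\mu_h^{m+1/2}\|_{L^2}^2+\sum_{m=1}^{\ell}\Big[\frac1{4\varepsilon}\|\phi_h^{m+1}-2\phi_h^m+\phi_h^{m-1}\|_{L^2}^2+\frac{\varepsilon}{8}\|\nabla\phi_h^{m+1}-2\nabla\phi_h^m+\nabla\phi_h^{m-1}\|_{L^2}^2\Big]=F(\phi_h^1,\phi_h^0),$$ where $$F(\phi,\psi):=E(\phi)+\frac1{4\varepsilon}\|\phi-\psi\|_{L^2}^2+\frac{\varepsilon}{8}\|\nabla\phi-\nabla\psi\|_{L^2}^2 .$$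
   Context: $\Omega\subset\mathbb{R}^d$, $d\in\{2,3\}$, is an open polygonal or polyhedral domain; $\varepsilon>0$; $(\cdot,\cdot)$ is the $L^2(\Omega)$ inner product and $a(u,v):=(\nabla u,\nabla v)$. $T>0$, $M$ is a positive integer, $\tau=T/M$. $\mathcal{T}_h$ is a conforming, shape-regular, quasi-uniform triangulation of $\Omega$, $q\ge1$ is an integer, $S_h:=\{v\in C^0(\Omega): v|_K\in\mathcal{P}_q(K)\ \forall K\in\mathcal{T}_h\}\subset H^1(\Omega)$. The energy is $E(\phi)=\int_\Omega\{\frac1{4\varepsilon}(\phi^2-1)^2+\frac{\varepsilon}{2}|\nabla\phi|^2\}dx$. The nonlinearity is $\chi(u,v):=\tfrac12(u^2+v^2)\cdot\tfrac12(u+v)$. Initial data: $\phi_h^0=R_h\phi_0$, $\mu_h^0=R_h\mu_0$, with $\phi_0\in H^2(\Omega)$, $\partial_n\phi_0=0$ on $\partial\Omega$, $\mu_0:=\varepsilon^{-1}(\phi_0^3-\phi_0)-\varepsilon\Delta\phi_0\in H^1(\Omega)$, where the Ritz projection $R_h:H^1(\Omega)\to S_h$ is defined by $a(R_h\phi-\phi,\xi)=0$ for all $\xi\in S_h$ and $(R_h\phi-\phi,1)=0$. First-step problem: find $\phi_h^1,\mu_h^{1/2}\in S_h$ such that for all $\nu,\psi\in S_h$: $\big(\tfrac{\phi_h^1-\phi_h^0}{\tau},\nu\big)+\varepsilon a(\mu_h^{1/2},\nu)=0$ and $\varepsilon^{-1}(\chi(\phi_h^1,\phi_h^0),\psi)-\varepsilon^{-1}(\phi_h^0,\psi)+\tfrac{\tau}{2}a(\mu_h^0,\psi)+\varepsilon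 a(\tfrac12\phi_h^1+\tfrac12\phi_h^0,\psi)-(\mu_h^{1/2},\psi)=0$. Multistep problem ($1\le m\le M-1$): given $\phi_h^m,\phi_h^{m-1}$, find $\phi_h^{m+1},\mu_h^{m+1/2}\in S_h$ such that for all $\nu,\psi\in S_h$: $\big(\tfrac{\phi_h^{m+1}-\phi_h^m}{\tau},\nu\big)+\varepsilon a(\mu_h^{m+1/2},\nu)=0$ and $\varepsilon^{-1}(\chi(\phi_h^{m+1},\phi_h^m),\psi)-\varepsilon^{-1}(\tfrac32\phi_h^m-\tfrac12\phi_h^{m-1},\psi)+\varepsilon a(\tfrac34\phi_h^{m+1}+\tfrac14\phi_h^{m-1},\psi)-(\mu_h^{m+1/2},\psi)=0$. Both problems are uniquely solvable. *)

theory Defs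
  imports "HOL-Analysis.Analysis"
begin

text \<open>Functions on an open set \<open>\<Omega>\<close> of \<open>\<real>\<^sup>d\<close> are total functions on \<open>real ^ 'd\<close>; only their
  values on \<open>\<Omega>\<close> matter, and elements of \<open>L\<^sup>2\<close>, \<open>H\<^sup>1\<close>, \<open>H\<^sup>2\<close> are represented by arbitrary members of
  their almost-everywhere classes.\<close>


subsection \<open>Lebesgue and Sobolev spaces\<close>

definition L2 :: "(real ^ 'd) set \<Rightarrow> (real ^ 'd \<Rightarrow> 'b::euclidean_space) set" where
  "L2 \<Omega> = {u. u \<in> borel_measurable (lebesgue_on \<Omega>) \<and>
              integrable (lebesgue_on \<Omega>) (\<lambda>x. (norm (u x))\<^sup>2)}"

definition L2_inner ::
  "(real ^ 'd) set \<Rightarrow> (real ^ 'd \<Rightarrow> 'b::euclidean_space) \<Rightarrow> (real ^ 'd \<Rightarrow> 'b) \<Rightarrow> real" where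
  "L2_inner \<Omega> u v = (LINT x|lebesgue_on \<Omega>. u x \<bullet> v x)"

definition L2_norm :: "(real ^ 'd) set \<Rightarrow> (real ^ 'd \<Rightarrow> 'b::euclidean_space) \<Rightarrow> real" where
  "L2_norm \<Omega> u = sqrt (L2_inner \<Omega> u u)"

definition partial_deriv :: "'d \<Rightarrow> (real ^ 'd \<Rightarrow> real) \<Rightarrow> real ^ 'd \<Rightarrow> real" where
  "partial_deriv i f x = frechet_derivative f (at x) (axis i 1)"

text \<open>If all iterated partial derivatives are differentiable, they are in particular all
  continuous, so this is \<open>C\<^sup>\<infinity>\<close>.\<close>

definition smooth :: "(real ^ 'd \<Rightarrow> real) \<Rightarrow> bool" where
  "smooth f \<longleftrightarrow> (\<forall>is. foldr partial_deriv is f differentiable_on UNIV)"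

definition test_functions :: "(real ^ 'd) set \<Rightarrow> (real ^ 'd \<Rightarrow> real) set" where
  "test_functions \<Omega> =
     {\<eta>. smooth \<eta> \<and> compact (closure {x. \<eta> x \<noteq> 0}) \<and> closure {x. \<eta> x \<noteq> 0} \<subseteq> \<Omega>}"

definition has_weak_grad ::
  "(real ^ 'd) set \<Rightarrow> (real ^ 'd \<Rightarrow> real) \<Rightarrow> (real ^ 'd \<Rightarrow> real ^ 'd) \<Rightarrow> bool" where
  "has_weak_grad \<Omega> u g \<longleftrightarrow>
     (\<forall>\<eta>\<in>test_functions \<Omega>. \<forall>i.
        (LINT x|lebesgue_on \<Omega>. u x * partial_deriv i \<eta> x) =
        - (LINT x|lebesgue_on \<Omega>. g x $ i * \<eta> x))"

definition H1 :: "(real ^ 'd) set \<Rightarrow> (real ^ 'd \<Rightarrow> real) set" where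
  "H1 \<Omega> = {u \<in> L2 \<Omega>. \<exists>g\<in>L2 \<Omega>. has_weak_grad \<Omega> u g}"

definition weak_grad :: "(real ^ 'd) set \<Rightarrow> (real ^ 'd \<Rightarrow> real) \<Rightarrow> real ^ 'd \<Rightarrow> real ^ 'd" where
  "weak_grad \<Omega> u = (SOME g. g \<in> L2 \<Omega> \<and> has_weak_grad \<Omega> u g)"

definition H2 :: "(real ^ 'd) set \<Rightarrow> (real ^ 'd \<Rightarrow> real) set" where
  "H2 \<Omega> = {u \<in> H1 \<Omega>. \<forall>i. (\<lambda>x. weak_grad \<Omega> u x $ i) \<in> H1 \<Omega>}"

definition weak_laplacian :: "(real ^ 'd) set \<Rightarrow> (real ^ 'd \<Rightarrow> real) \<Rightarrow> real ^ 'd \<Rightarrow> real" where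
  "weak_laplacian \<Omega> u x = (\<Sum>i\<in>UNIV. weak_grad \<Omega> (\<lambda>y. weak_grad \<Omega> u y $ i) x $ i)"

definition grad_form ::
  "(real ^ 'd) set \<Rightarrow> (real ^ 'd \<Rightarrow> real) \<Rightarrow> (real ^ 'd \<Rightarrow> real) \<Rightarrow> real" where
  "grad_form \<Omega> u v = L2_inner \<Omega> (weak_grad \<Omega> u) (weak_grad \<Omega> v)"

text \<open>The normal derivative of \<open>u \<in> H\<^sup>2(\<Omega>)\<close> is the normal trace of the \<open>H(div)\<close> field \<open>\<nabla>u\<close>, i.e. the
  functional \<open>v \<mapsto> \<integral>\<^sub>\<partial>\<^sub>\<Omega> (\<partial>\<^sub>n u) v = (\<Delta>u, v) + (\<nabla>u, \<nabla>v)\<close> on (traces of) \<open>H\<^sup>1(\<Omega>)\<close>.\<close>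

definition normal_deriv ::
  "(real ^ 'd) set \<Rightarrow> (real ^ 'd \<Rightarrow> real) \<Rightarrow> (real ^ 'd \<Rightarrow> real) \<Rightarrow> real" where
  "normal_deriv \<Omega> u v = L2_inner \<Omega> (weak_laplacian \<Omega> u) v + grad_form \<Omega> u v"

definition zero_normal_deriv :: "(real ^ 'd) set \<Rightarrow> (real ^ 'd \<Rightarrow> real) \<Rightarrow> bool" where
  "zero_normal_deriv \<Omega> u \<longleftrightarrow> (\<forall>v\<in>H1 \<Omega>. normal_deriv \<Omega> u v = 0)"


subsection \<open>Meshes and the finite element space\<close>

definition polyhedral_domain :: "(real ^ 'd) set \<Rightarrow> bool" where
  "polyhedral_domain \<Omega> \<longleftrightarrow>
     open \<Omega> \<and> connected \<Omega> \<and> bounded \<Omega> \<and> \<Omega> \<noteq> {} \<and>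
     (\<exists>\<F>. finite \<F> \<and> (\<forall>F\<in>\<F>. polytope F \<and> aff_dim F = int CARD('d) - 1) \<and>
          frontier \<Omega> = \<Union>\<F>)"

text \<open>Conformity is the face condition contained in \<^const>\<open>triangulation\<close>.\<close>

definition conforming_mesh :: "(real ^ 'd) set \<Rightarrow> (real ^ 'd) set set \<Rightarrow> bool" where
  "conforming_mesh \<Omega> \<T> \<longleftrightarrow>
     triangulation \<T> \<and> (\<forall>K\<in>\<T>. int CARD('d) simplex K \<and> interior K \<subseteq> \<Omega>) \<and> \<Union>\<T> = closure \<Omega>"

definition mesh_size :: "(real ^ 'd) set set \<Rightarrow> real" where
  "mesh_size \<T> = Max (diameter ` \<T>)"

definition inball_diameter :: "(real ^ 'd) set \<Rightarrow> real" where
  "inball_diameter K = Sup {2 * r | r. 0 \<le> r \<and> (\<exists>x. cball x r \<subseteq> K)}"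

text \<open>Shape regularity and quasi-uniformity are properties of a family \<open>(\<T> h)\<^sub>h\<close>, \<open>h\<close> ranging over a
  set \<open>H\<close> of mesh sizes: the constants do not depend on \<open>h\<close>.\<close>

definition shape_regular :: "real set \<Rightarrow> (real \<Rightarrow> (real ^ 'd) set set) \<Rightarrow> bool" where
  "shape_regular H \<T> \<longleftrightarrow>
     (\<exists>\<sigma>>0. \<forall>h\<in>H. \<forall>K\<in>\<T> h. diameter K \<le> \<sigma> * inball_diameter K)"

definition quasi_uniform :: "real set \<Rightarrow> (real \<Rightarrow> (real ^ 'd) set set) \<Rightarrow> bool" where
  "quasi_uniform H \<T> \<longleftrightarrow>
     (\<exists>c>0. \<forall>h\<in>H. \<forall>K\<in>\<T> h. c * mesh_size (\<T> h) \<le> diameter K)"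

definition mesh_family ::
  "(real ^ 'd) set \<Rightarrow> real set \<Rightarrow> (real \<Rightarrow> (real ^ 'd) set set) \<Rightarrow> bool" where
  "mesh_family \<Omega> H \<T> \<longleftrightarrow>
     (\<forall>h\<in>H. h > 0 \<and> conforming_mesh \<Omega> (\<T> h) \<and> mesh_size (\<T> h) = h) \<and>
     shape_regular H \<T> \<and> quasi_uniform H \<T>"

definition polys :: "nat \<Rightarrow> (real ^ 'd \<Rightarrow> real) set" where
  "polys q = {p. \<exists>c :: ('d \<Rightarrow> nat) \<Rightarrow> real. \<forall>x.
     p x = (\<Sum>\<alpha> | (\<Sum>i\<in>UNIV. \<alpha> i) \<le> q. c \<alpha> * (\<Prod>i\<in>UNIV. (x $ i) ^ \<alpha> i))}"

definition fe_space :: "(real ^ 'd) set \<Rightarrow> (real ^ 'd) set set \<Rightarrow> nat \<Rightarrow> (real ^ 'd \<Rightarrow> real) set" where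
  "fe_space \<Omega> \<T> q =
     {v. continuous_on \<Omega> v \<and> (\<forall>K\<in>\<T>. \<exists>p\<in>polys q. \<forall>x\<in>K \<inter> \<Omega>. v x = p x)}"

text \<open>\<open>is_ritz_projection \<Omega> S u w\<close> says \<open>w = R\<^sub>h u\<close>. It is a relation because \<open>w\<close> is determined only
  on \<open>\<Omega>\<close>.\<close>

definition is_ritz_projection ::
  "(real ^ 'd) set \<Rightarrow> (real ^ 'd \<Rightarrow> real) set \<Rightarrow> (real ^ 'd \<Rightarrow> real) \<Rightarrow> (real ^ 'd \<Rightarrow> real) \<Rightarrow> bool" where
  "is_ritz_projection \<Omega> S u w \<longleftrightarrow>
     w \<in> S \<and>
     (\<forall>\<xi>\<in>S. grad_form \<Omega> (\<lambda>x. w x - u x) \<xi> = 0) \<and>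
     L2_inner \<Omega> (\<lambda>x. w x - u x) (\<lambda>x. 1) = 0"


subsection \<open>The Cahn--Hilliard scheme\<close>

definition chi :: "real \<Rightarrow> real \<Rightarrow> real" where
  "chi u v = (1/2) * (u\<^sup>2 + v\<^sup>2) * ((1/2) * (u + v))"

definition energy :: "(real ^ 'd) set \<Rightarrow> real \<Rightarrow> (real ^ 'd \<Rightarrow> real) \<Rightarrow> real" where
  "energy \<Omega> \<epsilon> \<phi> =
     (LINT x|lebesgue_on \<Omega>.
        1 / (4 * \<epsilon>) * ((\<phi> x)\<^sup>2 - 1)\<^sup>2 + \<epsilon> / 2 * (norm (weak_grad \<Omega> \<phi> x))\<^sup>2)"

definition modified_energy ::
  "(real ^ 'd) set \<Rightarrow> real \<Rightarrow> (real ^ 'd \<Rightarrow> real) \<Rightarrow> (real ^ 'd \<Rightarrow> real) \<Rightarrow> real" where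
  "modified_energy \<Omega> \<epsilon> \<phi> \<psi> =
     energy \<Omega> \<epsilon> \<phi>
     + 1 / (4 * \<epsilon>) * (L2_norm \<Omega> (\<lambda>x. \<phi> x - \<psi> x))\<^sup>2
     + \<epsilon> / 8 * (L2_norm \<Omega> (\<lambda>x. weak_grad \<Omega> \<phi> x - weak_grad \<Omega> \<psi> x))\<^sup>2"

definition initial_potential ::
  "(real ^ 'd) set \<Rightarrow> real \<Rightarrow> (real ^ 'd \<Rightarrow> real) \<Rightarrow> real ^ 'd \<Rightarrow> real" where
  "initial_potential \<Omega> \<epsilon> \<phi>\<^sub>0 x =
     inverse \<epsilon> * ((\<phi>\<^sub>0 x) ^ 3 - \<phi>\<^sub>0 x) - \<epsilon> * weak_laplacian \<Omega> \<phi>\<^sub>0 x"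

text \<open>Below, \<open>S\<close> is the finite element space, \<open>\<phi>old\<close> stands for \<open>\<phi>\<^sub>h\<^sup>0\<close>, \<open>\<mu>old\<close> for \<open>\<mu>\<^sub>h\<^sup>0\<close>,
  \<open>\<phi>new\<close> for \<open>\<phi>\<^sub>h\<^sup>1\<close> and \<open>\<mu>half\<close> for \<open>\<mu>\<^sub>h\<^bsup>1/2\<^esup>\<close>.\<close>

definition first_step ::
  "(real ^ 'd) set \<Rightarrow> (real ^ 'd \<Rightarrow> real) set \<Rightarrow> real \<Rightarrow> real \<Rightarrow>
   (real ^ 'd \<Rightarrow> real) \<Rightarrow> (real ^ 'd \<Rightarrow> real) \<Rightarrow>
   (real ^ 'd \<Rightarrow> real) \<Rightarrow> (real ^ 'd \<Rightarrow> real) \<Rightarrow> bool" where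
  "first_step \<Omega> S \<epsilon> \<tau> \<phi>old \<mu>old \<phi>new \<mu>half \<longleftrightarrow>
     \<phi>new \<in> S \<and> \<mu>half \<in> S \<and>
     (\<forall>\<nu>\<in>S. \<forall>\<psi>\<in>S.
        L2_inner \<Omega> (\<lambda>x. (\<phi>new x - \<phi>old x) / \<tau>) \<nu> + \<epsilon> * grad_form \<Omega> \<mu>half \<nu> = 0 \<and>
        inverse \<epsilon> * L2_inner \<Omega> (\<lambda>x. chi (\<phi>new x) (\<phi>old x)) \<psi>
        - inverse \<epsilon> * L2_inner \<Omega> \<phi>old \<psi>
        + \<tau> / 2 * grad_form \<Omega> \<mu>old \<psi>
        + \<epsilon> * grad_form \<Omega> (\<lambda>x. 1/2 * \<phi>new x + 1/2 * \<phi>old x) \<psi>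
        - L2_inner \<Omega> \<mu>half \<psi> = 0)"

text \<open>Here \<open>\<phi>prev\<close>, \<open>\<phi>old\<close>, \<open>\<phi>new\<close> stand for \<open>\<phi>\<^sub>h\<^bsup>m-1\<^esup>\<close>, \<open>\<phi>\<^sub>h\<^sup>m\<close>, \<open>\<phi>\<^sub>h\<^bsup>m+1\<^esup>\<close> and
  \<open>\<mu>half\<close> for \<open>\<mu>\<^sub>h\<^bsup>m+1/2\<^esup>\<close>.\<close>

definition multistep ::
  "(real ^ 'd) set \<Rightarrow> (real ^ 'd \<Rightarrow> real) set \<Rightarrow> real \<Rightarrow> real \<Rightarrow>
   (real ^ 'd \<Rightarrow> real) \<Rightarrow> (real ^ 'd \<Rightarrow> real) \<Rightarrow>
   (real ^ 'd \<Rightarrow> real) \<Rightarrow> (real ^ 'd \<Rightarrow> real) \<Rightarrow> bool" where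
  "multistep \<Omega> S \<epsilon> \<tau> \<phi>prev \<phi>old \<phi>new \<mu>half \<longleftrightarrow>
     \<phi>new \<in> S \<and> \<mu>half \<in> S \<and>
     (\<forall>\<nu>\<in>S. \<forall>\<psi>\<in>S.
        L2_inner \<Omega> (\<lambda>x. (\<phi>new x - \<phi>old x) / \<tau>) \<nu> + \<epsilon> * grad_form \<Omega> \<mu>half \<nu> = 0 \<and>
        inverse \<epsilon> * L2_inner \<Omega> (\<lambda>x. chi (\<phi>new x) (\<phi>old x)) \<psi>
        - inverse \<epsilon> * L2_inner \<Omega> (\<lambda>x. 3/2 * \<phi>old x - 1/2 * \<phi>prev x) \<psi>
        + \<epsilon> * grad_form \<Omega> (\<lambda>x. 3/4 * \<phi>new x + 1/4 * \<phi>prev x) \<psi>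
        - L2_inner \<Omega> \<mu>half \<psi> = 0)"

end

theory Submission
  imports Defs
begin

text \<open>
  Test the first equation of the scheme with \<open>\<nu> = \<mu>\<^sub>h\<^bsup>m+1/2\<^esup>\<close> and the second with
  \<open>\<psi> = \<phi>\<^sub>h\<^bsup>m+1\<^esup> - \<phi>\<^sub>h\<^sup>m\<close>. With \<open>a, b, c\<close> for the new, old and previous values, the nonlinear and the
  gradient terms are exact differences up to second differences:
  \<open>chi a b (a - b) - (3/2 b - 1/2 c) (a - b)
     = 1/4 [(a\<^sup>2 - 1)\<^sup>2 - (b\<^sup>2 - 1)\<^sup>2 + (a - b)\<^sup>2 - (b - c)\<^sup>2 + (a - 2 b + c)\<^sup>2]\<close> and
  \<open>(3/4 a + 1/4 c) (a - b) = 1/2 (a\<^sup>2 - b\<^sup>2) + 1/8 [(a - b)\<^sup>2 - (b - c)\<^sup>2 + (a - 2 b + c)\<^sup>2]\<close>,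
  so the identity telescopes.

  Since \<^const>\<open>weak_grad\<close> is an arbitrary choice, it is linear only almost everywhere and only on
  \<open>H\<^sup>1\<close>. Uniqueness of weak gradients comes from smooth bumps approximating indicators of boxes.
  Finite element functions lie in \<open>H\<^sup>1\<close> because they are Lipschitz along segments in \<open>\<Omega>\<close> and
  differentiable off the cell boundaries.
\<close>

subsection \<open>Smooth bump functions\<close>

text \<open>For \<open>p = 1\<close> this is the classical flat function exp(-c/s), extended by 0 to
  s \<le> 0. The polynomial in 1/s makes the family closed under differentiation, and letting
  \<open>c\<close> tend to 0 sharpens it to a step function.\<close>

definition flat_exp :: "real \<Rightarrow> real poly \<Rightarrow> real \<Rightarrow> real" where
  "flat_exp c p s = (if s \<le> 0 then 0 else poly p (1 / s) * exp (- (c / s)))"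

text \<open>Monomial by monomial, the substitution of \<open>c * y\<close> reduces this to the decay
  of y^k / exp y. It controls \<open>flat_exp\<close> at 0 from the right, with y = 1/s.\<close>

lemma tendsto_poly_mult_exp_neg_at_top:
  fixes p :: "real poly"
  assumes "c > 0"
  shows "((\<lambda>y. poly p y * exp (- (c * y))) \<longlongrightarrow> 0) at_top"
proof -
  have mono: "((\<lambda>y. y ^ k * exp (- (c * y))) \<longlongrightarrow> 0) at_top" for k
  proof -
    have "filterlim (\<lambda>y. c * y) at_top at_top"
      using assms by (intro filterlim_tendsto_pos_mult_at_top[OF tendsto_const _ filterlim_ident])
    from filterlim_compose[OF tendsto_power_div_exp_0[of k] this]
    have "((\<lambda>y. (1 / c ^ k) * ((c * y) ^ k / exp (c * y))) \<longlongrightarrow> (1 / c ^ k) * 0) at_top"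
      by (intro tendsto_mult tendsto_const)
    moreover have "(\<lambda>y. (1 / c ^ k) * ((c * y) ^ k / exp (c * y))) = (\<lambda>y. y ^ k * exp (- (c * y)))"
      using assms by (auto simp: power_mult_distrib exp_minus field_simps)
    ultimately show ?thesis by simp
  qed
  have "((\<lambda>y. \<Sum>k\<le>degree p. coeff p k * (y ^ k * exp (- (c * y)))) \<longlongrightarrow>
          (\<Sum>k\<le>degree p. coeff p k * 0)) at_top"
    by (intro tendsto_sum tendsto_mult tendsto_const mono)
  then show ?thesis
    by (simp add: poly_altdef sum_distrib_right mult.assoc)
qed

text \<open>For s > 0 put y = 1/s: since dy/ds = -y^2, differentiating p(y) exp(-c y) gives y^2 (c
  p(y) - p'(y)) exp(-c y), which is the polynomial in the statement. At 0 both one-sided difference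
  quotients tend to 0.\<close>

lemma flat_exp_has_field_derivative:
  assumes "c > 0"
  shows "(flat_exp c p has_field_derivative
            flat_exp c ([:0, 0, 1:] * (smult c p - pderiv p)) s) (at s)"
proof (cases s "0 :: real" rule: linorder_cases)
  case less
  have "((\<lambda>_. 0) has_field_derivative 0) (at s)" by simp
  then have "(flat_exp c p has_field_derivative 0) (at s)"
    by (rule has_field_derivative_transform_within_open[where S = "{..<0}"])
       (use less in \<open>auto simp: flat_exp_def\<close>)
  then show ?thesis using less by (simp add: flat_exp_def)
next
  case greater
  have "((\<lambda>s. poly p (1 / s) * exp (- (c / s))) has_field_derivative
      (poly (pderiv p) (1 / s) * (- 1 / s\<^sup>2)) * exp (- (c / s))
      + (exp (- (c / s)) * (c / s\<^sup>2)) * poly p (1 / s)) (at s)"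
    using greater
    by (auto intro!: derivative_eq_intros DERIV_chain2[OF poly_DERIV] simp: power2_eq_square)
  then have "(flat_exp c p has_field_derivative
      (poly (pderiv p) (1 / s) * (- 1 / s\<^sup>2)) * exp (- (c / s))
      + (exp (- (c / s)) * (c / s\<^sup>2)) * poly p (1 / s)) (at s)"
    by (rule has_field_derivative_transform_within_open[where S = "{0<..}"])
       (use greater in \<open>auto simp: flat_exp_def\<close>)
  moreover have "(poly (pderiv p) (1 / s) * (- 1 / s\<^sup>2)) * exp (- (c / s))
      + (exp (- (c / s)) * (c / s\<^sup>2)) * poly p (1 / s)
      = flat_exp c ([:0, 0, 1:] * (smult c p - pderiv p)) s"
    using greater by (simp add: flat_exp_def power2_eq_square field_simps)
  ultimately show ?thesis by simp
next
  case equal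
  have inv: "filterlim (\<lambda>h::real. 1 / h) at_top (at_right 0)"
    by (simp add: inverse_eq_divide[symmetric] filterlim_inverse_at_top_right)
  \<comment> \<open>Dividing by \<open>h\<close> adds one factor 1/h, that is, it multiplies the
    polynomial in 1/h by its variable; hence \<open>pCons 0 p\<close>.\<close>
  have "((\<lambda>h. poly (pCons 0 p) (1 / h) * exp (- (c * (1 / h)))) \<longlongrightarrow> 0) (at_right 0)"
    by (rule filterlim_compose[OF tendsto_poly_mult_exp_neg_at_top[OF assms] inv])
  then have "((\<lambda>h. (flat_exp c p (0 + h) - flat_exp c p 0) / h) \<longlongrightarrow> 0) (at_right 0)"
    by (rule Lim_transform_eventually)
       (auto simp: flat_exp_def eventually_at_right_field intro!: exI[of _ 1])
  moreover have "((\<lambda>h. (flat_exp c p (0 + h) - flat_exp c p 0) / h) \<longlongrightarrow> 0) (at_left 0)"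
    by (rule Lim_transform_eventually[OF tendsto_const])
       (auto simp: flat_exp_def eventually_at_left_field intro!: exI[of _ "-1"])
  ultimately have "(flat_exp c p has_field_derivative 0) (at 0)"
    unfolding DERIV_def by (simp add: filterlim_at_split)
  then show ?thesis using equal by (simp add: flat_exp_def)
qed

text \<open>Members are differentiable with partial derivatives again in the algebra, hence smooth.\<close>

inductive flat_algebra :: "(real ^ 'd \<Rightarrow> real) \<Rightarrow> bool" where
  const: "flat_algebra (\<lambda>x. a)"
| flat: "c > 0 \<Longrightarrow> flat_algebra (\<lambda>x. flat_exp c p (\<alpha> * x $ i + \<beta>))"
| add: "flat_algebra f \<Longrightarrow> flat_algebra g \<Longrightarrow> flat_algebra (\<lambda>x. f x + g x)"
| mult: "flat_algebra f \<Longrightarrow> flat_algebra g \<Longrightarrow> flat_algebra (\<lambda>x. f x * g x)"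

lemma partial_deriv_eqI:
  "(f has_derivative D) (at x) \<Longrightarrow> partial_deriv i f x = D (axis i 1)"
  unfolding partial_deriv_def by (simp add: frechet_derivative_at[symmetric])

text \<open>Differentiability and closure share one induction because the sum and product rules for
  \<open>partial_deriv\<close> need both operands to be differentiable.\<close>

lemma flat_algebra_partial_deriv:
  assumes "flat_algebra f"
  shows "(\<forall>x. f differentiable (at x)) \<and> (\<forall>j. flat_algebra (partial_deriv j f))"
  using assms
proof induction
  case (const a)
  have "partial_deriv j (\<lambda>x. a) = (\<lambda>x. 0)" for j :: 'a
    by (auto simp: partial_deriv_eqI[OF has_derivative_const])
  then show ?case by (auto intro: flat_algebra.const)
next
  case (flat c p \<alpha> i \<beta>)
  let ?f = "\<lambda>x::real^'a. flat_exp c p (\<alpha> * x $ i + \<beta>)"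
  let ?q = "[:0, 0, 1:] * (smult c p - pderiv p)"
  have D: "(?f has_derivative (\<lambda>h. (\<alpha> * h $ i) * flat_exp c ?q (\<alpha> * x $ i + \<beta>))) (at x)" for x
  proof -
    have "((\<lambda>x::real^'a. \<alpha> * x $ i + \<beta>) has_derivative (\<lambda>h. \<alpha> * h $ i)) (at x)"
      by (auto intro!: derivative_eq_intros bounded_linear.has_derivative[OF bounded_linear_vec_nth])
    from has_derivative_compose[OF this
        flat_exp_has_field_derivative[OF flat, unfolded has_field_derivative_def, of p "\<alpha> * x $ i + \<beta>"]]
    show ?thesis by (simp add: mult.commute)
  qed
  \<comment> \<open>The factor \<open>axis j 1 $ i\<close> is a Kronecker delta, so j = i and j
    \<noteq> i need no case split.\<close>
  have "partial_deriv j ?f = (\<lambda>x. (\<alpha> * (axis j 1 :: real^'a) $ i) * flat_exp c ?q (\<alpha> * x $ i + \<beta>))" for j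
    using partial_deriv_eqI[OF D] by auto
  then show ?case
    using D flat by (auto intro!: flat_algebra.intros simp: differentiable_def simp del: mult_pCons_left)
next
  case (add f g)
  have D: "((\<lambda>x. f x + g x) has_derivative
        (\<lambda>h. frechet_derivative f (at x) h + frechet_derivative g (at x) h)) (at x)" for x
    using add by (intro has_derivative_add) (auto simp: frechet_derivative_works[symmetric])
  have "partial_deriv j (\<lambda>x. f x + g x) = (\<lambda>x. partial_deriv j f x + partial_deriv j g x)" for j
    using partial_deriv_eqI[OF D] by (auto simp: partial_deriv_def)
  then show ?case using D add by (auto intro: flat_algebra.intros simp: differentiable_def)
next
  case (mult f g)
  have D: "((\<lambda>x. f x * g x) has_derivative
        (\<lambda>h. f x * frechet_derivative g (at x) h + frechet_derivative f (at x) h * g x)) (at x)" for x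
    using mult by (intro has_derivative_mult) (auto simp: frechet_derivative_works[symmetric])
  have "partial_deriv j (\<lambda>x. f x * g x) =
      (\<lambda>x. f x * partial_deriv j g x + partial_deriv j f x * g x)" for j
    using partial_deriv_eqI[OF D] by (auto simp: partial_deriv_def)
  then show ?case using D mult by (auto intro!: flat_algebra.intros simp: differentiable_def)
qed

lemma flat_algebra_smooth:
  assumes "flat_algebra f"
  shows "smooth f"
proof -
  have "flat_algebra (foldr partial_deriv is f)" for "is"
    by (induction "is") (use assms flat_algebra_partial_deriv in auto)
  then show ?thesis
    using flat_algebra_partial_deriv
    by (auto simp: smooth_def differentiable_on_def intro: differentiable_at_withinI)
qed

section \<open>Bumps supported in boxes\<close>

lemma flat_algebra_prod:
  "finite I \<Longrightarrow> (\<And>i. i \<in> I \<Longrightarrow> flat_algebra (f i)) \<Longrightarrow> flat_algebra (\<lambda>x. \<Prod>i\<in>I. f i x)"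
  by (induction I rule: finite_induct) (auto intro: flat_algebra.intros)

text \<open>A tensor product of flat functions, one for each face of the box. The parameter
  \<open>c\<close> sets the sharpness: the indicator of the open box is the limit as
  \<open>c\<close> decreases to 0.\<close>

definition box_bump :: "real \<Rightarrow> real ^ 'd \<Rightarrow> real ^ 'd \<Rightarrow> real ^ 'd \<Rightarrow> real" where
  "box_bump c a b x = (\<Prod>i\<in>UNIV. flat_exp c 1 (x $ i - a $ i) * flat_exp c 1 (b $ i - x $ i))"

lemma smooth_box_bump: "c > 0 \<Longrightarrow> smooth (box_bump c a b)"
proof (rule flat_algebra_smooth)
  assume "c > 0"
  \<comment> \<open>The arguments are spelled as \<alpha> * x + \<beta> with slopes 1 and -1 to
    match the rule \<open>flat\<close>.\<close>
  then have "flat_algebra (\<lambda>x. flat_exp c 1 (1 * x $ i + - (a $ i)) * flat_exp c 1 (- 1 * x $ i + b $ i))" for i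
    by (intro flat_algebra.intros)
  then have "flat_algebra (\<lambda>x. \<Prod>i\<in>UNIV. flat_exp c 1 (1 * x $ i + - (a $ i)) * flat_exp c 1 (- 1 * x $ i + b $ i))"
    by (intro flat_algebra_prod) auto
  then show "flat_algebra (box_bump c a b)"
    by (simp add: box_bump_def[abs_def])
qed

lemma box_bump_eq_0:
  fixes x :: "real ^ 'd"
  assumes "x \<notin> box a b" shows "box_bump c a b x = 0"
proof -
  obtain i where "\<not> (a $ i < x $ i \<and> x $ i < b $ i)"
    using assms by (auto simp: mem_box_cart)
  then have "flat_exp c 1 (x $ i - a $ i) * flat_exp c 1 (b $ i - x $ i) = 0"
    by (auto simp: flat_exp_def)
  then show ?thesis
    unfolding box_bump_def by (intro prod_zero) auto
qed

lemma box_bump_bounded: "c > 0 \<Longrightarrow> \<bar>box_bump c a b x\<bar> \<le> 1"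
  unfolding box_bump_def abs_prod
  by (intro prod_le_1) (auto simp: flat_exp_def abs_mult mult_le_one)

text \<open>Inside the box every factor is exp(-c/s) at a fixed s > 0 and tends to 1; elsewhere,
  boundary included, all terms are 0.\<close>

lemma box_bump_tendsto: "(\<lambda>n. box_bump (1 / real (Suc n)) a b x) \<longlonglongrightarrow> indicator (box a b) x"
proof (cases "x \<in> box a b")
  case True
  have "(\<lambda>n. flat_exp (1 / real (Suc n)) 1 s) \<longlonglongrightarrow> 1" if "s > 0" for s
  proof -
    have "(\<lambda>n. exp (- ((1 / real (Suc n)) / s))) \<longlonglongrightarrow> exp (- (0 / s))"
      using that by (intro tendsto_intros LIMSEQ_Suc[OF lim_1_over_n]) auto
    then show ?thesis using that by (simp add: flat_exp_def)
  qed
  then have "(\<lambda>n. box_bump (1 / real (Suc n)) a b x) \<longlonglongrightarrow> (\<Prod>i\<in>(UNIV::'a set). 1 * 1)"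
    unfolding box_bump_def using True by (intro tendsto_prod tendsto_mult) (auto simp: mem_box_cart)
  then show ?thesis using True by simp
qed (simp add: box_bump_eq_0)

text \<open>Supports are closures, so it is the closed box that has to lie in \<Omega>; it also
  makes the support compact.\<close>

lemma box_bump_test_function:
  assumes "c > 0" "cbox a b \<subseteq> \<Omega>"
  shows "box_bump c a b \<in> test_functions \<Omega>"
proof -
  have "closure {x. box_bump c a b x \<noteq> 0} \<subseteq> cbox a b"
    using box_bump_eq_0[of _ a b c] box_subset_cbox[of a b] 
    by (intro closure_minimal) auto
  moreover from this have "compact (closure {x. box_bump c a b x \<noteq> 0})"
    by (meson bounded_cbox bounded_subset closed_closure compact_eq_bounded_closed)
  ultimately show ?thesis
    using assms smooth_box_bump by (auto simp: test_functions_def)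
qed

subsection \<open>Fundamental lemma of the calculus of variations\<close>

lemma smooth_differentiable: "smooth f \<Longrightarrow> f differentiable (at x)"
  unfolding smooth_def differentiable_on_def by (drule spec[of _ "[]"]) simp

lemma smooth_partial_deriv: "smooth f \<Longrightarrow> smooth (partial_deriv i f)"
  unfolding smooth_def
proof
  fix "is" assume *: "\<forall>is. foldr partial_deriv is f differentiable_on UNIV"
  show "foldr partial_deriv is (partial_deriv i f) differentiable_on UNIV"
    using *[THEN spec, of "is @ [i]"] by simp
qed

lemma smooth_continuous_on: "smooth f \<Longrightarrow> continuous_on S f"
  by (meson smooth_differentiable continuous_at_imp_continuous_on differentiable_imp_continuous_within)

text \<open>A pi-lambda argument: open boxes are stable under intersection and generate the Borel
  sets, so the truncation \<open>g\<close> of \<open>f\<close> to \<open>box a b\<close> has zero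
  integral over every Borel set and is therefore zero almost everywhere.\<close>

lemma AE_zero_on_box_if_subbox_integrals_zero:
  fixes f :: "'a::euclidean_space \<Rightarrow> real"
  assumes f: "integrable lborel f"
    and zero: "\<And>c d. box c d \<subseteq> box a b \<Longrightarrow> (LINT x:box c d|lborel. f x) = 0"
  shows "AE x in lborel. x \<in> box a b \<longrightarrow> f x = 0"
proof -
  define g where "g x = indicator (box a b) x *\<^sub>R f x" for x
  have g: "integrable lborel g"
    unfolding g_def by (intro integrable_mult_indicator f) auto
  have set_int: "set_integrable lborel A g" if "A \<in> sets lborel" for A
    unfolding set_integrable_def by (intro integrable_mult_indicator g that)
  \<comment> \<open>Needed for complements, whose integral is the total minus that over the
    set.\<close>
  have total: "(LINT x|lborel. g x) = 0"
    using zero[of a b] by (simp add: g_def set_lebesgue_integral_def)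
  have "(LINT x:A|lborel. g x) = 0" if "A \<in> sets lborel" for A
  proof -
    have "Int_stable (range (\<lambda>(c, d). box c d :: 'a set))"
      by (auto simp: Int_stable_def box_Int_box)
    moreover have "range (\<lambda>(c, d). box c d :: 'a set) \<subseteq> Pow UNIV" by simp
    moreover have "A \<in> sigma_sets UNIV (range (\<lambda>(c, d). box c d :: 'a set))"
      using that by (simp add: borel_eq_box)
    ultimately show ?thesis
    proof (induction rule: sigma_sets_induct_disjoint)
      case (basic A)
      then obtain c d where A: "A = box c d" by auto
      obtain c' d' where "box c d \<inter> box a b = box c' d'"
        by (rule that[OF box_Int_box])
      moreover from this have "(LINT x:box c' d'|lborel. f x) = 0"
        by (intro zero) (metis Int_lower2)
      ultimately show ?case
        by (simp add: A g_def set_lebesgue_integral_def indicator_inter_arith[symmetric] mult.assoc[symmetric])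
    next
      case empty then show ?case by (simp add: set_lebesgue_integral_def)
    next
      case (compl A)
      then have A: "A \<in> sets lborel" by (simp add: borel_eq_box)
      have "(LINT x|lborel. g x) = (LINT x:A \<union> (UNIV - A)|lborel. g x)"
        by (simp add: set_lebesgue_integral_def)
      also have "\<dots> = (LINT x:A|lborel. g x) + (LINT x:UNIV - A|lborel. g x)"
        using A by (intro set_integral_Un set_int) auto
      finally show ?case using compl total by simp
    next
      case (union A)
      then have A: "A i \<in> sets lborel" for i by (auto simp: borel_eq_box)
      have "(LINT x:(\<Union>i. A i)|lborel. g x) = (\<Sum>i. (LINT x:A i|lborel. g x))"
        using union.hyps A by (intro lebesgue_integral_countable_add set_int) (auto simp: disjoint_family_on_def)
      then show ?case using union by simp
    qed
  qed
  then have "AE x in lborel. g x = 0"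
    by (intro sigma_finite_measure.density_zero[OF sigma_finite_lborel] g) auto
  then show ?thesis by eventually_elim (auto simp: g_def)
qed

text \<open>Bumps converge boundedly to indicators of boxes, so dominated convergence makes the
  integral over each open box with closure in \<Omega> vanish. The box lemma and a countable cover
  of \<Omega> by closed boxes finish.\<close>

lemma AE_zero_if_test_integrals_zero:
  fixes f :: "real ^ 'd \<Rightarrow> real"
  assumes "open \<Omega>" and f: "integrable (lebesgue_on \<Omega>) f"
    and test: "\<And>\<eta>. \<eta> \<in> test_functions \<Omega> \<Longrightarrow> (LINT x|lebesgue_on \<Omega>. f x * \<eta> x) = 0"
  shows "AE x in lebesgue_on \<Omega>. f x = 0"
proof -
  have \<Omega>: "\<Omega> \<inter> space lebesgue \<in> sets lebesgue" using \<open>open \<Omega>\<close> by auto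
  have F: "integrable lebesgue (\<lambda>x. indicator \<Omega> x *\<^sub>R f x)"
    using f integrable_restrict_space[OF \<Omega>] by blast
  \<comment> \<open>A Borel representative of the extension of \<open>f\<close> by zero, so that the
    argument on boxes can run over \<open>lborel\<close>.\<close>
  then obtain g where g: "g \<in> borel_measurable lborel" "AE x in lborel. indicator \<Omega> x *\<^sub>R f x = g x"
    using completion_ex_borel_measurable_real by blast
  have ae: "AE x in lebesgue. indicator \<Omega> x *\<^sub>R f x = g x"
    using g by (intro AE_completion)
  have gm: "g \<in> borel_measurable lebesgue"
    using g(1) by (simp add: measurable_completion)
  have "integrable lebesgue g"
    using integrable_cong_AE[OF borel_measurable_integrable[OF F] gm ae] F by blast
  then have gi: "integrable lborel g"
    using integrable_completion g(1) by blast
  have box: "(LINT x:box a b|lborel. g x) = 0" if ab: "cbox a b \<subseteq> \<Omega>" for a b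
  proof -
    let ?\<eta> = "\<lambda>n. box_bump (1 / real (Suc n)) a b"
    have \<eta>m: "?\<eta> n \<in> borel_measurable borel" for n
      by (intro borel_measurable_continuous_onI smooth_continuous_on smooth_box_bump) simp
    have \<eta>l: "?\<eta> n \<in> borel_measurable lebesgue" for n
      by (intro measurable_completion) (use \<eta>m in simp)
    have "(\<lambda>n. LINT x|lborel. g x * ?\<eta> n x) \<longlonglongrightarrow> (LINT x|lborel. g x * indicator (box a b) x)"
    proof (rule integral_dominated_convergence[where w = "\<lambda>x. \<bar>g x\<bar>"])
      show "AE x in lborel. (\<lambda>n. g x * ?\<eta> n x) \<longlonglongrightarrow> g x * indicator (box a b) x"
        by (intro AE_I2 tendsto_mult tendsto_const box_bump_tendsto)
      show "AE x in lborel. norm (g x * ?\<eta> n x) \<le> \<bar>g x\<bar>" for n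
        using box_bump_bounded[of "1 / real (Suc n)" a b]
        by (auto simp: abs_mult intro!: mult_left_le)
    qed (use g \<eta>m gi in auto)
    moreover have "(LINT x|lborel. g x * ?\<eta> n x) = 0" for n
    proof -
      have "(LINT x|lborel. g x * ?\<eta> n x) = (LINT x|lebesgue. g x * ?\<eta> n x)"
        using g \<eta>m by (intro integral_completion[symmetric]) auto
      also have "\<dots> = (LINT x|lebesgue. indicator \<Omega> x *\<^sub>R (f x * ?\<eta> n x))"
      proof (rule integral_cong_AE)
        show "(\<lambda>x. g x * ?\<eta> n x) \<in> borel_measurable lebesgue"
          using gm \<eta>l by (rule borel_measurable_times)
        show "(\<lambda>x. indicator \<Omega> x *\<^sub>R (f x * ?\<eta> n x)) \<in> borel_measurable lebesgue"
          using borel_measurable_times[OF borel_measurable_integrable[OF F] \<eta>l, of n]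
          by (simp add: mult.assoc)
        show "AE x in lebesgue. g x * ?\<eta> n x = indicator \<Omega> x *\<^sub>R (f x * ?\<eta> n x)"
          using ae by eventually_elim auto
      qed
      also have "\<dots> = 0"
        using test[OF box_bump_test_function[OF _ ab, of "1 / real (Suc n)"]]
        by (simp add: integral_restrict_space[OF \<Omega>])
      finally show ?thesis .
    qed
    ultimately show ?thesis
      by (simp add: LIMSEQ_const_iff set_lebesgue_integral_def mult.commute)
  qed
  \<comment> \<open>Countability of the cover lets the exceptional null sets be united.\<close>
  obtain \<D> where \<D>: "countable \<D>" "\<D> \<subseteq> Pow \<Omega>" "\<And>X. X \<in> \<D> \<Longrightarrow> \<exists>a b. X = cbox a b" "\<Union>\<D> = \<Omega>"
    using open_countable_Union_open_cbox[OF \<open>open \<Omega>\<close>] by metis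
  have "AE x in lborel. \<forall>X\<in>\<D>. x \<in> X \<longrightarrow> g x = 0"
  proof (subst AE_ball_countable[OF \<D>(1)], safe)
    fix X assume X: "X \<in> \<D>"
    then obtain a b where ab: "X = cbox a b" using \<D> by blast
    \<comment> \<open>A nonempty subbox has its closed box as closure, which stays inside
      \<open>cbox a b\<close>; thus \<open>box\<close> applies to it.\<close>
    have "cbox c d \<subseteq> \<Omega>" if "box c d \<subseteq> box a b" "box c d \<noteq> {}" for c d
    proof -
      have "cbox c d = closure (box c d)" using that by (simp add: closure_box)
      also have "\<dots> \<subseteq> cbox a b" using that by (intro closure_minimal) (use box_subset_cbox in auto)
      finally show ?thesis using X \<D>(2) ab by auto
    qed
    then have "(LINT x:box c d|lborel. g x) = 0" if "box c d \<subseteq> box a b" for c d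
      using that box[of c d] by (cases "box c d = {}") (auto simp: set_lebesgue_integral_def)
    then have "AE x in lborel. x \<in> box a b \<longrightarrow> g x = 0"
      by (rule AE_zero_on_box_if_subbox_integrals_zero[OF gi])
    \<comment> \<open>The cover consists of closed boxes while vanishing is known on open ones; the
      faces between them are negligible.\<close>
    moreover have "AE x in lborel. x \<notin> cbox a b - box a b"
    proof (rule AE_not_in)
      have "negligible (cbox a b - box a b)" by (rule negligible_frontier_interval)
      then show "cbox a b - box a b \<in> null_sets lborel"
        by (simp add: negligible_iff_null_sets null_sets_completion_iff)
    qed
    ultimately show "AE x in lborel. x \<in> X \<longrightarrow> g x = 0"
      by eventually_elim (auto simp: ab)
  qed
  then have "AE x in lebesgue. \<forall>X\<in>\<D>. x \<in> X \<longrightarrow> g x = 0" by (rule AE_completion)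
  with ae have "AE x in lebesgue. x \<in> \<Omega> \<longrightarrow> f x = 0"
    by eventually_elim (use \<D>(4) in \<open>auto simp: indicator_def\<close>)
  then show ?thesis using AE_restrict_space_iff[OF \<Omega>] by blast
qed

subsection \<open>Linearity of the weak gradient\<close>

lemma test_function_smooth: "\<eta> \<in> test_functions \<Omega> \<Longrightarrow> smooth \<eta>"
  by (simp add: test_functions_def)

text \<open>Off its closed support the function is locally constant 0, so differentiation does not
  enlarge the support.\<close>

lemma test_function_partial_deriv:
  assumes "\<eta> \<in> test_functions \<Omega>"
  shows "partial_deriv i \<eta> \<in> test_functions \<Omega>"
proof -
  let ?K = "closure {x. \<eta> x \<noteq> 0}"
  have "partial_deriv i \<eta> x = 0" if "x \<notin> ?K" for x
  proof -
    have "((\<lambda>_. 0) has_derivative (\<lambda>_. 0)) (at x)" by simp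
    then have "(\<eta> has_derivative (\<lambda>_. 0)) (at x)"
      by (rule has_derivative_transform_within_open[where s = "- ?K"])
         (use that in \<open>auto dest: contra_subsetD[OF closure_subset]\<close>)
    then show ?thesis by (rule partial_deriv_eqI)
  qed
  then have "closure {x. partial_deriv i \<eta> x \<noteq> 0} \<subseteq> ?K"
    by (intro closure_minimal) auto
  then show ?thesis
    using assms smooth_partial_deriv unfolding test_functions_def
    by (auto simp: compact_eq_bounded_closed intro: bounded_subset)
qed

lemma test_function_bounded:
  assumes "\<eta> \<in> test_functions \<Omega>"
  obtains B where "\<And>x. \<bar>\<eta> x\<bar> \<le> B"
proof -
  let ?K = "closure {x. \<eta> x \<noteq> 0}"
  have "compact (\<eta> ` ?K)"
    using assms by (intro compact_continuous_image smooth_continuous_on) (auto simp: test_functions_def)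
  then have "bounded (\<eta> ` ?K)" by (rule compact_imp_bounded)
  then obtain B where B: "\<And>x. x \<in> ?K \<Longrightarrow> \<bar>\<eta> x\<bar> \<le> B"
    unfolding bounded_iff real_norm_def by blast
  have "\<bar>\<eta> x\<bar> \<le> max B 0" for x
    using B[of x] closure_subset[of "{x. \<eta> x \<noteq> 0}"] by (cases "\<eta> x = 0") auto
  then show ?thesis using that by blast
qed

section \<open>Square integrable functions on bounded open sets\<close>

lemma finite_measure_lebesgue_on_bounded_open:
  fixes \<Omega> :: "'a::euclidean_space set"
  assumes "open \<Omega>" "bounded \<Omega>"
  shows "finite_measure (lebesgue_on \<Omega>)"
proof (rule finite_measureI)
  have "\<Omega> \<in> lmeasurable" using assms lmeasurable_open by blast
  then show "emeasure (lebesgue_on \<Omega>) (space (lebesgue_on \<Omega>)) \<noteq> \<infinity>"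
    using fmeasurableD2[of \<Omega> lebesgue] by (simp add: space_restrict_space emeasure_restrict_space fmeasurableD)
qed

lemma L2_bounded:
  fixes u :: "real ^ 'd \<Rightarrow> 'b::euclidean_space"
  assumes "open \<Omega>" "bounded \<Omega>" "u \<in> borel_measurable (lebesgue_on \<Omega>)"
    "\<And>x. x \<in> \<Omega> \<Longrightarrow> norm (u x) \<le> B"
  shows "u \<in> L2 \<Omega>"
proof -
  interpret finite_measure "lebesgue_on \<Omega>" using finite_measure_lebesgue_on_bounded_open assms by blast
  have "integrable (lebesgue_on \<Omega>) (\<lambda>x. (norm (u x))\<^sup>2)"
    by (rule integrable_const_bound[where B = "B\<^sup>2"])
       (use assms in \<open>auto simp: space_restrict_space intro!: AE_I2 power_mono\<close>)
  with assms show ?thesis by (simp add: L2_def)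
qed

lemma L2_test_function:
  assumes "open \<Omega>" "bounded \<Omega>" "\<eta> \<in> test_functions \<Omega>"
  shows "\<eta> \<in> L2 \<Omega>"
proof -
  obtain B where "\<And>x. \<bar>\<eta> x\<bar> \<le> B" using test_function_bounded assms by blast
  moreover have "\<eta> \<in> borel_measurable (lebesgue_on \<Omega>)"
    using assms test_function_smooth
    by (intro continuous_imp_measurable_on_sets_lebesgue smooth_continuous_on) auto
  ultimately show ?thesis using assms by (intro L2_bounded[where B = B]) auto
qed

lemma L2_inner_integrable:
  assumes "u \<in> L2 \<Omega>" "v \<in> L2 \<Omega>"
  shows "integrable (lebesgue_on \<Omega>) (\<lambda>x. u x \<bullet> v x)"
proof (rule Bochner_Integration.integrable_bound)
  show "integrable (lebesgue_on \<Omega>) (\<lambda>x. (norm (u x))\<^sup>2 + (norm (v x))\<^sup>2)"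
    using assms by (intro Bochner_Integration.integrable_add) (auto simp: L2_def)
  show "(\<lambda>x. u x \<bullet> v x) \<in> borel_measurable (lebesgue_on \<Omega>)"
    using assms by (auto simp: L2_def)
  have "norm (u x \<bullet> v x) \<le> (norm (u x))\<^sup>2 + (norm (v x))\<^sup>2" for x
  proof -
    have "norm (u x \<bullet> v x) \<le> norm (u x) * norm (v x)"
      using Cauchy_Schwarz_ineq2 by simp
    also have "\<dots> \<le> (norm (u x))\<^sup>2 + (norm (v x))\<^sup>2"
      using sum_squares_bound[of "norm (u x)" "norm (v x)"] mult_nonneg_nonneg[OF norm_ge_zero[of "u x"] norm_ge_zero[of "v x"]]
      unfolding mult.assoc by linarith
    finally show ?thesis .
  qed
  then show "AE x in lebesgue_on \<Omega>. norm (u x \<bullet> v x) \<le> norm ((norm (u x))\<^sup>2 + (norm (v x))\<^sup>2)"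
    by (intro AE_I2) (auto intro: order_trans)
qed

lemma L2_mult_integrable:
  fixes u v :: "real ^ 'd \<Rightarrow> real"
  shows "u \<in> L2 \<Omega> \<Longrightarrow> v \<in> L2 \<Omega> \<Longrightarrow> integrable (lebesgue_on \<Omega>) (\<lambda>x. u x * v x)"
  using L2_inner_integrable[of u \<Omega> v] by (simp only: inner_real_def)

text \<open>The expanded square has a mixed term u \<bullet> v, which is integrable by
  \<open>L2_inner_integrable\<close>.\<close>

lemma L2_lincomb:
  assumes "u \<in> L2 \<Omega>" "v \<in> L2 \<Omega>"
  shows "(\<lambda>x. a *\<^sub>R u x + b *\<^sub>R v x) \<in> L2 \<Omega>"
proof -
  have "(norm (a *\<^sub>R u x + b *\<^sub>R v x))\<^sup>2 =
      a\<^sup>2 * (norm (u x))\<^sup>2 + 2 * a * b * (u x \<bullet> v x) + b\<^sup>2 * (norm (v x))\<^sup>2" for x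
    unfolding power2_norm_eq_inner
    by (simp add: inner_add_left inner_add_right inner_commute algebra_simps power2_eq_square)
  then show ?thesis
    using assms L2_inner_integrable[OF assms] by (auto simp: L2_def)
qed

lemma L2_component: "g \<in> L2 \<Omega> \<Longrightarrow> (\<lambda>x. g x $ i) \<in> L2 \<Omega>"
  for g :: "real ^ 'd \<Rightarrow> real ^ 'n"
proof -
  assume g: "g \<in> L2 \<Omega>"
  have m: "(\<lambda>x. g x $ i) \<in> borel_measurable (lebesgue_on \<Omega>)"
    using g by (auto simp: L2_def intro!: measurable_compose[OF _ borel_measurable_nth])
  have "integrable (lebesgue_on \<Omega>) (\<lambda>x. (norm (g x $ i))\<^sup>2)"
    by (rule Bochner_Integration.integrable_bound[where f = "\<lambda>x. (norm (g x))\<^sup>2"])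
       (use g m in \<open>auto simp: L2_def intro!: AE_I2 abs_le_square_iff[THEN iffD1] component_le_norm_cart\<close>)
  with m show ?thesis by (simp add: L2_def)
qed

lemma L2_integrable:
  fixes u :: "real ^ 'd \<Rightarrow> real"
  assumes "open \<Omega>" "bounded \<Omega>" "u \<in> L2 \<Omega>"
  shows "integrable (lebesgue_on \<Omega>) u"
proof -
  have "(\<lambda>x. 1::real) \<in> L2 \<Omega>" using assms by (intro L2_bounded[where B = 1]) auto
  from L2_mult_integrable[OF assms(3) this] show ?thesis by simp
qed

text \<open>Integrals split only for integrable integrands; here each one is a product of two
  \<open>L2\<close> functions, test functions being in \<open>L2\<close> because \<Omega> is
  bounded.\<close>

lemma has_weak_grad_lincomb:
  assumes "open \<Omega>" "bounded \<Omega>" "u \<in> L2 \<Omega>" "v \<in> L2 \<Omega>" "g \<in> L2 \<Omega>" "h \<in> L2 \<Omega>"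
    and "has_weak_grad \<Omega> u g" "has_weak_grad \<Omega> v h"
  shows "has_weak_grad \<Omega> (\<lambda>x. a * u x + b * v x) (\<lambda>x. a *\<^sub>R g x + b *\<^sub>R h x)"
  unfolding has_weak_grad_def
proof (intro ballI allI)
  fix \<eta> i assume \<eta>: "\<eta> \<in> test_functions \<Omega>"
  have L: "\<eta> \<in> L2 \<Omega>" "partial_deriv i \<eta> \<in> L2 \<Omega>"
    using \<eta> assms L2_test_function test_function_partial_deriv by blast+
  have "(LINT x|lebesgue_on \<Omega>. (a * u x + b * v x) * partial_deriv i \<eta> x)
      = a * (LINT x|lebesgue_on \<Omega>. u x * partial_deriv i \<eta> x)
        + b * (LINT x|lebesgue_on \<Omega>. v x * partial_deriv i \<eta> x)"
    using L2_mult_integrable[OF assms(3) L(2)] L2_mult_integrable[OF assms(4) L(2)]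
    by (simp add: distrib_right mult.assoc)
  moreover have "(LINT x|lebesgue_on \<Omega>. (a *\<^sub>R g x + b *\<^sub>R h x) $ i * \<eta> x)
      = a * (LINT x|lebesgue_on \<Omega>. g x $ i * \<eta> x) + b * (LINT x|lebesgue_on \<Omega>. h x $ i * \<eta> x)"
    using L2_mult_integrable[OF L2_component[OF assms(5)] L(1)]
      L2_mult_integrable[OF L2_component[OF assms(6)] L(1)]
    by (simp add: distrib_right mult.assoc)
  ultimately show "(LINT x|lebesgue_on \<Omega>. (a * u x + b * v x) * partial_deriv i \<eta> x)
      = - (LINT x|lebesgue_on \<Omega>. (a *\<^sub>R g x + b *\<^sub>R h x) $ i * \<eta> x)"
    using assms(7,8) \<eta> by (simp add: has_weak_grad_def)
qed

text \<open>Each component of g - h integrates to zero against all test functions, so the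
  fundamental lemma applies to it, and there are only finitely many components.\<close>

lemma has_weak_grad_unique:
  fixes g h :: "real ^ 'd \<Rightarrow> real ^ 'd"
  assumes "open \<Omega>" "bounded \<Omega>" "g \<in> L2 \<Omega>" "h \<in> L2 \<Omega>"
    and "has_weak_grad \<Omega> u g" "has_weak_grad \<Omega> u h"
  shows "AE x in lebesgue_on \<Omega>. g x = h x"
proof -
  have "AE x in lebesgue_on \<Omega>. g x $ i - h x $ i = 0" for i
  proof (rule AE_zero_if_test_integrals_zero[OF \<open>open \<Omega>\<close>])
    show "integrable (lebesgue_on \<Omega>) (\<lambda>x. g x $ i - h x $ i)"
      using assms by (intro Bochner_Integration.integrable_diff L2_integrable L2_component)
    fix \<eta> assume \<eta>: "\<eta> \<in> test_functions \<Omega>"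
    have "(LINT x|lebesgue_on \<Omega>. (g x $ i - h x $ i) * \<eta> x)
        = (LINT x|lebesgue_on \<Omega>. g x $ i * \<eta> x) - (LINT x|lebesgue_on \<Omega>. h x $ i * \<eta> x)"
      using L2_mult_integrable[OF L2_component[OF assms(3)] L2_test_function[OF assms(1,2) \<eta>]]
        L2_mult_integrable[OF L2_component[OF assms(4)] L2_test_function[OF assms(1,2) \<eta>]]
      by (simp add: left_diff_distrib)
    then show "(LINT x|lebesgue_on \<Omega>. (g x $ i - h x $ i) * \<eta> x) = 0"
      using assms(5)[unfolded has_weak_grad_def, THEN bspec, OF \<eta>, THEN spec, of i]
        assms(6)[unfolded has_weak_grad_def, THEN bspec, OF \<eta>, THEN spec, of i]
      by simp
  qed
  then have "AE x in lebesgue_on \<Omega>. \<forall>i. g x $ i - h x $ i = 0"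
    by (simp add: AE_all_countable)
  then show ?thesis by eventually_elim (simp add: vec_eq_iff)
qed

lemma weak_grad_H1:
  assumes "u \<in> H1 \<Omega>"
  shows "weak_grad \<Omega> u \<in> L2 \<Omega>" "has_weak_grad \<Omega> u (weak_grad \<Omega> u)"
proof -
  have "\<exists>g. g \<in> L2 \<Omega> \<and> has_weak_grad \<Omega> u g" using assms by (auto simp: H1_def)
  from someI_ex[OF this] show "weak_grad \<Omega> u \<in> L2 \<Omega>" "has_weak_grad \<Omega> u (weak_grad \<Omega> u)"
    by (auto simp: weak_grad_def)
qed

text \<open>The combination of the two chosen gradients is one weak gradient of the combined
  function; uniqueness compares it with the one that \<open>weak_grad\<close> picks.\<close>

lemma H1_lincomb:
  assumes "open \<Omega>" "bounded \<Omega>" "u \<in> H1 \<Omega>" "v \<in> H1 \<Omega>"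
  shows "(\<lambda>x. a * u x + b * v x) \<in> H1 \<Omega>"
    and "AE x in lebesgue_on \<Omega>. weak_grad \<Omega> (\<lambda>x. a * u x + b * v x) x
           = a *\<^sub>R weak_grad \<Omega> u x + b *\<^sub>R weak_grad \<Omega> v x"
proof -
  let ?w = "\<lambda>x. a * u x + b * v x"
  let ?g = "\<lambda>x. a *\<^sub>R weak_grad \<Omega> u x + b *\<^sub>R weak_grad \<Omega> v x"
  have uv: "u \<in> L2 \<Omega>" "v \<in> L2 \<Omega>" using assms by (auto simp: H1_def)
  have g: "?g \<in> L2 \<Omega>" "has_weak_grad \<Omega> ?w ?g"
    using assms uv weak_grad_H1 by (auto intro!: L2_lincomb has_weak_grad_lincomb)
  show "?w \<in> H1 \<Omega>"
    using L2_lincomb[OF uv, of a b] g by (auto simp: H1_def)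
  then show "AE x in lebesgue_on \<Omega>. weak_grad \<Omega> ?w x = ?g x"
    using weak_grad_H1[of ?w \<Omega>] g assms by (intro has_weak_grad_unique) auto
qed

subsection \<open>Lipschitz functions are weakly differentiable\<close>

lemma integral_lborel_translation:
  fixes f :: "'a::euclidean_space \<Rightarrow> 'b::{banach, second_countable_topology}"
  assumes "f \<in> borel_measurable borel"
  shows "(LINT x|lborel. f (c + x)) = (LINT x|lborel. f x)"
proof -
  have "(LINT x|lborel. f (c + x)) = integral\<^sup>L (distr lborel borel ((+) c)) f"
    using assms by (intro integral_distr[symmetric]) auto
  then show ?thesis by (simp add: lborel_distr_plus)
qed

lemma integrable_lborel_bounded_support:
  fixes f :: "'a::euclidean_space \<Rightarrow> real"
  assumes "bounded \<Omega>" "f \<in> borel_measurable borel" "\<And>x. \<bar>f x\<bar> \<le> B" "\<And>x. x \<notin> \<Omega> \<Longrightarrow> f x = 0"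
  shows "integrable lborel f"
proof -
  obtain a where a: "\<Omega> \<subseteq> cbox (- a) a" using bounded_subset_cbox_symmetric assms(1) by blast
  show ?thesis
    by (rule integrableI_bounded_set[where A = "cbox (- a) a" and B = B])
       (use assms a in \<open>auto simp: emeasure_lborel_cbox_eq\<close>)
qed

lemma integral_lebesgue_on_eq_lborel:
  fixes f :: "'a::euclidean_space \<Rightarrow> real"
  assumes "open \<Omega>" "f \<in> borel_measurable borel" "\<And>x. x \<notin> \<Omega> \<Longrightarrow> f x = 0"
  shows "(LINT x|lebesgue_on \<Omega>. f x) = (LINT x|lborel. f x)"
proof -
  have "(LINT x|lebesgue_on \<Omega>. f x) = (LINT x|lebesgue. indicator \<Omega> x *\<^sub>R f x)"
    using \<open>open \<Omega>\<close> by (intro integral_restrict_space) auto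
  also have "(\<lambda>x. indicator \<Omega> x *\<^sub>R f x) = f"
    using assms(3) by (auto simp: indicator_def fun_eq_iff)
  also have "(LINT x|lebesgue. f x) = (LINT x|lborel. f x)"
    using assms(2) by (intro integral_completion) simp
  finally show ?thesis .
qed

lemma has_derivative_directional_field_derivative:
  fixes f :: "'a::real_normed_vector \<Rightarrow> real"
  assumes "(f has_derivative F) (at (x + t *\<^sub>R e))"
  shows "((\<lambda>t. f (x + t *\<^sub>R e)) has_field_derivative F e) (at t)"
proof -
  interpret bounded_linear F using assms by (rule has_derivative_bounded_linear)
  have "((\<lambda>t. x + t *\<^sub>R e) has_derivative (\<lambda>h. h *\<^sub>R e)) (at t)"
    by (auto intro!: derivative_eq_intros)
  from has_derivative_compose[OF this assms] show ?thesis
    by (simp add: has_field_derivative_def scaleR mult_commute_abs)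
qed

text \<open>The sign of \<open>s n\<close> is left open, so that the lemma serves forward quotients
  of test functions and backward quotients of the function itself.\<close>

lemma difference_quotient_tendsto:
  fixes f :: "'a::real_normed_vector \<Rightarrow> real"
  assumes "(f has_derivative F) (at x)" "s \<longlonglongrightarrow> 0" "\<And>n. s n \<noteq> 0"
  shows "(\<lambda>n. (f (x + s n *\<^sub>R e) - f x) / s n) \<longlonglongrightarrow> F e"
proof -
  have "((\<lambda>t. f (x + t *\<^sub>R e)) has_field_derivative F e) (at 0)"
    using assms(1) by (intro has_derivative_directional_field_derivative) simp
  then have "((\<lambda>h. (f (x + h *\<^sub>R e) - f x) / h) \<longlongrightarrow> F e) (at 0)"
    by (simp add: DERIV_def)
  moreover have "filterlim s (at 0) sequentially"
    using assms(2,3) by (simp add: filterlim_at)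
  ultimately show ?thesis by (rule filterlim_compose)
qed

text \<open>The weak gradient is the almost everywhere limit of backward difference quotients: a
  translation moves the forward difference quotient of the test function onto the function, and
  the Lipschitz bound dominates both sides.\<close>

lemma H1_if_Lipschitz_on_segments:
  fixes u :: "real ^ 'd \<Rightarrow> real"
  assumes \<Omega>: "open \<Omega>" "bounded \<Omega>" and cont: "continuous_on \<Omega> u"
    and B: "\<And>x. x \<in> \<Omega> \<Longrightarrow> \<bar>u x\<bar> \<le> B"
    and Lip: "\<And>x y. closed_segment x y \<subseteq> \<Omega> \<Longrightarrow> \<bar>u x - u y\<bar> \<le> L * norm (x - y)"
    and diff: "AE x in lebesgue. x \<in> \<Omega> \<longrightarrow> u differentiable (at x)"
  shows "u \<in> H1 \<Omega>"
proof -
  \<comment> \<open>Extension by zero gives a Borel function on the whole space, which may be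
    translated freely.\<close>
  define U where "U x = indicator \<Omega> x *\<^sub>R u x" for x
  define s where "s n = 1 / real (Suc n)" for n
  define D where "D i n x = (U (x + (- s n) *\<^sub>R axis i 1) - U x) / (- s n)" for i :: 'd and n x
  \<comment> \<open>Where the quotients diverge, \<open>lim\<close> has no meaningful value;
    clamping keeps \<open>g\<close> bounded everywhere. At points of \<Omega> where \<open>u\<close>
    is differentiable the limit already lies in [-L, L], so the clamp changes nothing there.\<close>
  define g where "g x = (\<chi> i. max (- L) (min L (lim (\<lambda>n. D i n x))))" for x
  have s: "s n > 0" "s \<longlonglongrightarrow> 0" for n
    unfolding s_def using LIMSEQ_Suc[OF lim_1_over_n] by auto
  have s0: "s n \<noteq> 0" for n using s(1)[of n] by simp
  have U_m [measurable]: "U \<in> borel_measurable borel"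
    unfolding U_def using cont \<Omega> by (intro borel_measurable_continuous_on_indicator) auto
  have U_B: "\<bar>U x\<bar> \<le> max B 0" for x using B[of x] by (auto simp: U_def indicator_def)
  have U_0: "U x = 0" if "x \<notin> \<Omega>" for x using that by (simp add: U_def)
  have D_m [measurable]: "D i n \<in> borel_measurable borel" for i n
    unfolding D_def by measurable
  have g_i: "(\<lambda>x. g x $ i) \<in> borel_measurable borel" for i
    unfolding g_def by simp
  then have g_m: "g \<in> borel_measurable borel"
    by (subst borel_measurable_euclidean_space) (auto simp: Basis_vec_def inner_axis)
  \<comment> \<open>The ball keeps the whole backward step inside \<Omega>, so \<open>Lip\<close>
    applies and \<open>U\<close> equals \<open>u\<close> at both ends.\<close>
  have D_L: "\<bar>D i n x\<bar> \<le> L" if "ball x \<delta> \<subseteq> \<Omega>" "s n < \<delta>" for i n x \<delta>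
  proof -
    let ?y = "x + (- s n) *\<^sub>R axis i 1"
    have "norm (?y - x) = s n" using s(1)[of n] by simp
    then have "?y \<in> ball x \<delta>" "x \<in> ball x \<delta>"
      using that s(1)[of n] by (auto simp: dist_norm norm_minus_commute)
    then have seg: "closed_segment ?y x \<subseteq> \<Omega>"
      using that(1) closed_segment_subset[OF _ _ convex_ball] by blast
    then have "?y \<in> \<Omega>" "x \<in> \<Omega>" by auto
    then have "\<bar>U ?y - U x\<bar> \<le> L * s n"
      using Lip[OF seg] \<open>norm (?y - x) = s n\<close> by (simp add: U_def)
    then show ?thesis
      using s(1)[of n] by (simp add: D_def abs_divide divide_le_eq)
  qed
  have D_lim: "(\<lambda>n. D i n x) \<longlonglongrightarrow> g x $ i" if x: "x \<in> \<Omega>" and d: "u differentiable (at x)" for x i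
  proof -
    obtain F where F: "(u has_derivative F) (at x)" using d by (auto simp: differentiable_def)
    have "(U has_derivative F) (at x)"
      by (rule has_derivative_transform_within_open[OF F \<Omega>(1) x]) (simp add: U_def)
    then have lim: "(\<lambda>n. D i n x) \<longlonglongrightarrow> F (axis i 1)"
      unfolding D_def using s(2) s0 by (intro difference_quotient_tendsto) (auto intro: tendsto_eq_intros)
    obtain \<delta> where \<delta>: "\<delta> > 0" "ball x \<delta> \<subseteq> \<Omega>" using \<Omega>(1) x open_contains_ball by blast
    have "\<forall>\<^sub>F n in sequentially. s n < \<delta>" using s(2) \<delta>(1) by (rule order_tendstoD)
    then have "\<forall>\<^sub>F n in sequentially. \<bar>D i n x\<bar> \<le> L"
      by eventually_elim (rule D_L[OF \<delta>(2)])
    then have "\<bar>F (axis i 1)\<bar> \<le> L"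
      by (intro tendsto_upperbound[OF tendsto_rabs[OF lim]]) auto
    then have "g x $ i = F (axis i 1)" using limI[OF lim] by (simp add: g_def)
    then show ?thesis using lim by simp
  qed
  have has_wg: "has_weak_grad \<Omega> u g"
    unfolding has_weak_grad_def
  proof (intro ballI allI)
    fix \<eta> and i :: 'd assume \<eta>: "\<eta> \<in> test_functions \<Omega>"
    let ?e = "axis i 1 :: real ^ 'd" and ?K = "closure {x. \<eta> x \<noteq> 0}"
    have d\<eta>: "partial_deriv i \<eta> \<in> test_functions \<Omega>" using \<eta> by (rule test_function_partial_deriv)
    have K: "compact ?K" "?K \<subseteq> \<Omega>" using \<eta> by (auto simp: test_functions_def)
    have \<eta>_0: "\<eta> x = 0" if "x \<notin> ?K" for x
      using that closure_subset[of "{x. \<eta> x \<noteq> 0}"] by auto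
    have \<eta>_\<Omega>: "\<eta> x = 0" if "x \<notin> \<Omega>" for x
      using \<eta>_0 that K(2) by blast
    have m [measurable]: "\<eta> \<in> borel_measurable borel" "partial_deriv i \<eta> \<in> borel_measurable borel"
      using \<eta> d\<eta> by (auto intro!: borel_measurable_continuous_onI smooth_continuous_on test_function_smooth)
    obtain C where C: "\<And>x. \<bar>\<eta> x\<bar> \<le> C" using test_function_bounded[OF \<eta>] by blast
    obtain C' where C': "\<And>x. \<bar>partial_deriv i \<eta> x\<bar> \<le> C'" using test_function_bounded[OF d\<eta>] by blast
    have \<eta>_deriv: "(\<eta> has_derivative frechet_derivative \<eta> (at x)) (at x)" for x
      using smooth_differentiable[OF test_function_smooth[OF \<eta>]] by (simp add: frechet_derivative_works)
    \<comment> \<open>The mean value theorem along the i-th axis gives a bound uniform in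
      \<open>n\<close>, as domination requires.\<close>
    have quot_le: "\<bar>(\<eta> (x + s n *\<^sub>R ?e) - \<eta> x) / s n\<bar> \<le> C'" for x n
    proof -
      have "\<exists>z. 0 < z \<and> z < s n \<and> \<eta> (x + s n *\<^sub>R ?e) - \<eta> (x + 0 *\<^sub>R ?e) = (s n - 0) * partial_deriv i \<eta> (x + z *\<^sub>R ?e)"
        unfolding partial_deriv_def
        by (rule MVT2[OF s(1)]) (intro has_derivative_directional_field_derivative \<eta>_deriv)
      then obtain z where "\<eta> (x + s n *\<^sub>R ?e) - \<eta> x = s n * partial_deriv i \<eta> (x + z *\<^sub>R ?e)" by auto
      then show ?thesis using C' s(1)[of n] by simp
    qed
    have lhs: "(\<lambda>n. LINT x|lborel. U x * ((\<eta> (x + s n *\<^sub>R ?e) - \<eta> x) / s n))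
        \<longlonglongrightarrow> (LINT x|lborel. U x * partial_deriv i \<eta> x)"
    proof (rule integral_dominated_convergence[where w = "\<lambda>x. \<bar>U x\<bar> * C'"])
      show "integrable lborel (\<lambda>x. \<bar>U x\<bar> * C')"
        by (intro integrable_mult_left integrable_abs integrable_lborel_bounded_support[OF \<Omega>(2) U_m U_B U_0])
      show "AE x in lborel. (\<lambda>n. U x * ((\<eta> (x + s n *\<^sub>R ?e) - \<eta> x) / s n)) \<longlonglongrightarrow> U x * partial_deriv i \<eta> x"
        unfolding partial_deriv_def using s(2) s0
        by (intro AE_I2 tendsto_mult tendsto_const difference_quotient_tendsto \<eta>_deriv)
           auto
      show "AE x in lborel. norm (U x * ((\<eta> (x + s n *\<^sub>R ?e) - \<eta> x) / s n)) \<le> \<bar>U x\<bar> * C'" for n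
        unfolding real_norm_def abs_mult by (intro AE_I2 mult_left_mono quot_le) simp
    qed measurable
    \<comment> \<open>Discrete integration by parts: translating by \<open>- s n\<close> along the
      axis moves the shift from \<eta> to \<open>U\<close>, turning a forward quotient into a
      backward one.\<close>
    have parts: "(LINT x|lborel. U x * ((\<eta> (x + s n *\<^sub>R ?e) - \<eta> x) / s n))
        = - (LINT x|lborel. D i n x * \<eta> x)" for n
    proof -
      let ?c = "(- s n) *\<^sub>R ?e"
      have I0: "integrable lborel (\<lambda>x. U x * \<eta> x)"
        by (rule integrable_lborel_bounded_support[OF \<Omega>(2), where B = "max B 0 * C"])
           (use U_0 in \<open>auto simp: abs_mult intro!: mult_mono U_B C\<close>)
      have I1: "integrable lborel (\<lambda>x. U x * \<eta> (x + s n *\<^sub>R ?e))"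
        by (rule integrable_lborel_bounded_support[OF \<Omega>(2), where B = "max B 0 * C"])
           (use U_0 in \<open>auto simp: abs_mult intro!: mult_mono U_B C\<close>)
      have I2: "integrable lborel (\<lambda>x. U (x + ?c) * \<eta> x)"
        by (rule integrable_lborel_bounded_support[OF \<Omega>(2), where B = "max B 0 * C"])
           (use \<eta>_\<Omega> in \<open>auto simp: abs_mult intro!: mult_mono U_B C\<close>)
      have "(LINT x|lborel. U x * \<eta> (x + s n *\<^sub>R ?e)) = (LINT x|lborel. U (x + ?c) * \<eta> x)"
        using integral_lborel_translation[of "\<lambda>x. U x * \<eta> (x + s n *\<^sub>R ?e)" ?c]
        by (simp add: algebra_simps)
      moreover have "(LINT x|lborel. U x * ((\<eta> (x + s n *\<^sub>R ?e) - \<eta> x) / s n))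
          = ((LINT x|lborel. U x * \<eta> (x + s n *\<^sub>R ?e)) - (LINT x|lborel. U x * \<eta> x)) / s n"
        using I0 I1 by (simp add: right_diff_distrib)
      moreover have "(LINT x|lborel. D i n x * \<eta> x)
          = ((LINT x|lborel. U (x + ?c) * \<eta> x) - (LINT x|lborel. U x * \<eta> x)) / (- s n)"
        unfolding D_def times_divide_eq_left left_diff_distrib
        using I0 I2 by simp
      ultimately show ?thesis by simp
    qed
    \<comment> \<open>The compact support of \<eta> has a uniform margin \<delta> inside \<Omega>.
      From index \<open>N\<close> on, steps are shorter than \<delta> and \<open>D_L\<close> holds
      on the whole support; hence the shift by \<open>N\<close> below.\<close>
    obtain \<delta> where \<delta>: "\<delta> > 0" "(\<Union>x\<in>?K. ball x \<delta>) \<subseteq> \<Omega>"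
      using compact_subset_open_imp_ball_epsilon_subset[OF K(1) \<Omega>(1) K(2)] by blast
    have "\<forall>\<^sub>F n in sequentially. s n < \<delta>" using s(2) \<delta>(1) by (rule order_tendstoD)
    then obtain N where N: "\<And>n. n \<ge> N \<Longrightarrow> s n < \<delta>" by (auto simp: eventually_sequentially)
    have rhs: "(\<lambda>n. LINT x|lborel. D i (n + N) x * \<eta> x) \<longlonglongrightarrow> (LINT x|lborel. g x $ i * \<eta> x)"
    proof (rule integral_dominated_convergence[where w = "\<lambda>x. L * \<bar>\<eta> x\<bar>"])
      show "integrable lborel (\<lambda>x. L * \<bar>\<eta> x\<bar>)"
        by (intro integrable_mult_right integrable_abs integrable_lborel_bounded_support[OF \<Omega>(2) m(1) C])
           (use \<eta>_\<Omega> in auto)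
      have "AE x in lborel. x \<in> \<Omega> \<longrightarrow> u differentiable (at x)"
        using diff by (simp add: AE_completion_iff)
      then show "AE x in lborel. (\<lambda>n. D i (n + N) x * \<eta> x) \<longlonglongrightarrow> g x $ i * \<eta> x"
      proof eventually_elim
        case (elim x)
        show ?case
        proof (cases "x \<in> \<Omega>")
          case True
          then show ?thesis
            using elim by (intro tendsto_mult tendsto_const LIMSEQ_ignore_initial_segment[OF D_lim]) auto
        next
          case False
          then have "\<eta> x = 0" by (rule \<eta>_\<Omega>)
          then show ?thesis by simp
        qed
      qed
      show "AE x in lborel. norm (D i (n + N) x * \<eta> x) \<le> L * \<bar>\<eta> x\<bar>" for n
      proof (rule AE_I2)
        fix x
        show "norm (D i (n + N) x * \<eta> x) \<le> L * \<bar>\<eta> x\<bar>"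
        proof (cases "x \<in> ?K")
          case True
          then have "\<bar>D i (n + N) x\<bar> \<le> L" using \<delta> N by (intro D_L[of x \<delta>]) auto
          then show ?thesis by (auto simp: abs_mult intro: mult_right_mono)
        next
          case False
          then have "\<eta> x = 0" by (rule \<eta>_0)
          then show ?thesis by simp
        qed
      qed
    qed (use g_i D_m m in simp_all)
    have "(\<lambda>n. - (LINT x|lborel. D i (n + N) x * \<eta> x)) \<longlonglongrightarrow> (LINT x|lborel. U x * partial_deriv i \<eta> x)"
      using LIMSEQ_ignore_initial_segment[OF lhs, of N] unfolding parts .
    from LIMSEQ_unique[OF this tendsto_minus[OF rhs]]
    have eq: "(LINT x|lborel. U x * partial_deriv i \<eta> x) = - (LINT x|lborel. g x $ i * \<eta> x)" .
    have "(LINT x|lebesgue_on \<Omega>. u x * partial_deriv i \<eta> x) = (LINT x|lebesgue_on \<Omega>. U x * partial_deriv i \<eta> x)"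
      by (intro Bochner_Integration.integral_cong) (auto simp: U_def space_restrict_space)
    also have "\<dots> = (LINT x|lborel. U x * partial_deriv i \<eta> x)"
      using U_0 by (intro integral_lebesgue_on_eq_lborel \<Omega>) auto
    also have "\<dots> = - (LINT x|lebesgue_on \<Omega>. g x $ i * \<eta> x)"
      unfolding eq using \<eta>_\<Omega> g_i by (subst integral_lebesgue_on_eq_lborel[OF \<Omega>(1)]) auto
    finally show "(LINT x|lebesgue_on \<Omega>. u x * partial_deriv i \<eta> x)
        = - (LINT x|lebesgue_on \<Omega>. g x $ i * \<eta> x)" .
  qed
  have "norm (g x) \<le> real CARD('d) * \<bar>L\<bar>" for x
  proof -
    have "norm (g x) \<le> (\<Sum>i\<in>UNIV. \<bar>g x $ i\<bar>)" by (rule norm_le_l1_cart)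
    also have "\<dots> \<le> (\<Sum>i\<in>(UNIV :: 'd set). \<bar>L\<bar>)"
      by (intro sum_mono) (auto simp: g_def)
    finally show ?thesis by simp
  qed
  moreover have "g \<in> borel_measurable (lebesgue_on \<Omega>)"
    by (intro measurable_restrict_space1 measurable_completion) (use g_m in simp)
  ultimately have "g \<in> L2 \<Omega>" using \<Omega> by (intro L2_bounded)
  moreover have "u \<in> L2 \<Omega>"
    using \<Omega> cont B by (intro L2_bounded continuous_imp_measurable_on_sets_lebesgue) auto
  ultimately show ?thesis using has_wg by (auto simp: H1_def)
qed

subsection \<open>Finite element functions\<close>

lemma lipschitz_on_mult_bounded:
  fixes f g :: "'a::metric_space \<Rightarrow> real"
  assumes "L-lipschitz_on K f" "M-lipschitz_on K g" "A \<ge> 0" "B \<ge> 0"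
    "\<And>x. x \<in> K \<Longrightarrow> \<bar>f x\<bar> \<le> A" "\<And>x. x \<in> K \<Longrightarrow> \<bar>g x\<bar> \<le> B"
  shows "(A * M + B * L)-lipschitz_on K (\<lambda>x. f x * g x)"
proof (rule lipschitz_onI)
  fix x y assume xy: "x \<in> K" "y \<in> K"
  have "f x * g x - f y * g y = f x * (g x - g y) + g y * (f x - f y)" by (simp add: algebra_simps)
  then have "dist (f x * g x) (f y * g y) \<le> \<bar>f x\<bar> * \<bar>g x - g y\<bar> + \<bar>g y\<bar> * \<bar>f x - f y\<bar>"
    by (metis abs_mult abs_triangle_ineq dist_real_def)
  also have "\<dots> \<le> A * (M * dist x y) + B * (L * dist x y)"
    using assms(3-6) xy lipschitz_onD[OF assms(1) xy] lipschitz_onD[OF assms(2) xy]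
    by (intro add_mono mult_mono) (auto simp: dist_real_def)
  finally show "dist (f x * g x) (f y * g y) \<le> (A * M + B * L) * dist x y"
    by (simp add: algebra_simps)
next
  show "0 \<le> A * M + B * L"
    using assms lipschitz_on_nonneg[OF assms(1)] lipschitz_on_nonneg[OF assms(2)] by simp
qed

lemma compact_lipschitz_on_bounded:
  fixes f :: "'a::metric_space \<Rightarrow> real"
  assumes "compact K" "L-lipschitz_on K f"
  obtains A where "A \<ge> 0" "\<And>x. x \<in> K \<Longrightarrow> \<bar>f x\<bar> \<le> A"
proof -
  have "bounded (f ` K)"
    using assms lipschitz_on_continuous_on compact_continuous_image compact_imp_bounded by blast
  then obtain A where "\<And>x. x \<in> K \<Longrightarrow> \<bar>f x\<bar> \<le> A" unfolding bounded_iff real_norm_def by blast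
  then show ?thesis using that[of "max A 0"] by fastforce
qed

lemma ex_lipschitz_on_mult:
  fixes f g :: "'a::metric_space \<Rightarrow> real"
  assumes "compact K" "\<exists>L. L-lipschitz_on K f" "\<exists>L. L-lipschitz_on K g"
  shows "\<exists>L. L-lipschitz_on K (\<lambda>x. f x * g x)"
proof -
  obtain L M where LM: "L-lipschitz_on K f" "M-lipschitz_on K g" using assms by blast
  obtain A where A: "A \<ge> 0" "\<And>x. x \<in> K \<Longrightarrow> \<bar>f x\<bar> \<le> A"
    using compact_lipschitz_on_bounded[OF assms(1) LM(1)] by blast
  obtain B where B: "B \<ge> 0" "\<And>x. x \<in> K \<Longrightarrow> \<bar>g x\<bar> \<le> B"
    using compact_lipschitz_on_bounded[OF assms(1) LM(2)] by blast
  from lipschitz_on_mult_bounded[OF LM A(1) B(1) A(2) B(2)] show ?thesis by blast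
qed

lemma ex_lipschitz_on_power:
  fixes f :: "'a::metric_space \<Rightarrow> real"
  assumes "compact K" "\<exists>L. L-lipschitz_on K f"
  shows "\<exists>L. L-lipschitz_on K (\<lambda>x. f x ^ n)"
proof (induction n)
  case 0
  show ?case using lipschitz_on_constant by auto
next
  case (Suc n)
  from ex_lipschitz_on_mult[OF assms this] show ?case by simp
qed

lemma ex_lipschitz_on_prod:
  fixes f :: "'i \<Rightarrow> 'a::metric_space \<Rightarrow> real"
  assumes "compact K" "\<And>i. i \<in> I \<Longrightarrow> \<exists>L. L-lipschitz_on K (f i)"
  shows "\<exists>L. L-lipschitz_on K (\<lambda>x. \<Prod>i\<in>I. f i x)"
  using assms(2)
  \<comment> \<open>Over an infinite index set the product is constantly 1 by convention.\<close>
  by (induction I rule: infinite_finite_induct)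
     (auto intro: lipschitz_on_constant intro!: ex_lipschitz_on_mult[OF assms(1)])

lemma ex_lipschitz_on_sum:
  fixes f :: "'i \<Rightarrow> 'a::metric_space \<Rightarrow> real"
  assumes "\<And>i. i \<in> I \<Longrightarrow> \<exists>L. L-lipschitz_on K (f i)"
  shows "\<exists>L. L-lipschitz_on K (\<lambda>x. \<Sum>i\<in>I. f i x)"
  using assms
proof (induction I rule: infinite_finite_induct)
  case (insert i I)
  then obtain L M where "L-lipschitz_on K (f i)" "M-lipschitz_on K (\<lambda>x. \<Sum>i\<in>I. f i x)"
    by (meson insertCI)
  from lipschitz_on_add[OF this] show ?case using insert by auto
qed (auto intro: lipschitz_on_constant)

text \<open>Coordinates are 1-Lipschitz, and compactness bounds the factors, as the product rule for
  Lipschitz functions demands.\<close>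

lemma polys_lipschitz_on:
  assumes "compact K" "p \<in> polys q"
  shows "\<exists>L. L-lipschitz_on K p"
proof -
  obtain c where p: "p = (\<lambda>x. \<Sum>\<alpha> | (\<Sum>i\<in>UNIV. \<alpha> i) \<le> q. c \<alpha> * (\<Prod>i\<in>UNIV. (x $ i) ^ \<alpha> i))"
    using assms(2) by (auto simp: polys_def fun_eq_iff)
  have coord: "\<exists>L. L-lipschitz_on K (\<lambda>x. x $ i)" for i :: 'a
    by (rule exI[of _ 1], rule lipschitz_onI) (auto simp: dist_vec_nth_le)
  show ?thesis
    unfolding p
    by (intro ex_lipschitz_on_sum ex_lipschitz_on_mult ex_lipschitz_on_prod ex_lipschitz_on_power coord assms(1))
       (auto intro: lipschitz_on_constant)
qed

lemma polys_differentiable: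
  assumes "p \<in> polys q"
  shows "p differentiable (at x)"
proof -
  obtain c where p: "p = (\<lambda>x. \<Sum>\<alpha> | (\<Sum>i\<in>UNIV. \<alpha> i) \<le> q. c \<alpha> * (\<Prod>i\<in>UNIV. (x $ i) ^ \<alpha> i))"
    using assms(1) by (auto simp: polys_def fun_eq_iff)
  have coord: "((\<lambda>x. x $ i) has_derivative (\<lambda>x. x $ i)) (at x)" for i :: 'a and x
    by (intro bounded_linear_imp_has_derivative bounded_linear_vec_nth)
  show ?thesis
    unfolding p differentiable_def
    by (rule exI, rule has_derivative_sum, rule has_derivative_mult, rule has_derivative_const,
        rule has_derivative_prod, rule has_derivative_power, rule coord)
qed

lemma polys_lincomb:
  assumes "p \<in> polys q" "r \<in> polys q"
  shows "(\<lambda>x. a * p x + b * r x) \<in> polys q"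
proof -
  obtain c d where c: "\<And>x. p x = (\<Sum>\<alpha> | (\<Sum>i\<in>UNIV. \<alpha> i) \<le> q. c \<alpha> * (\<Prod>i\<in>UNIV. (x $ i) ^ \<alpha> i))"
    and d: "\<And>x. r x = (\<Sum>\<alpha> | (\<Sum>i\<in>UNIV. \<alpha> i) \<le> q. d \<alpha> * (\<Prod>i\<in>UNIV. (x $ i) ^ \<alpha> i))"
    using assms by (auto simp: polys_def)
  have "a * p x + b * r x = (\<Sum>\<alpha> | (\<Sum>i\<in>UNIV. \<alpha> i) \<le> q.
      (a * c \<alpha> + b * d \<alpha>) * (\<Prod>i\<in>UNIV. (x $ i) ^ \<alpha> i))" for x
    by (simp add: c d sum_distrib_left sum.distrib distrib_right mult.assoc)
  then show ?thesis by (auto simp: polys_def)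
qed

section \<open>Regularity of finite element functions\<close>

lemma fe_space_lincomb:
  assumes "u \<in> fe_space \<Omega> \<T> q" "v \<in> fe_space \<Omega> \<T> q"
  shows "(\<lambda>x. a * u x + b * v x) \<in> fe_space \<Omega> \<T> q"
proof -
  have "\<exists>p\<in>polys q. \<forall>x\<in>K \<inter> \<Omega>. a * u x + b * v x = p x" if "K \<in> \<T>" for K
  proof -
    obtain p r where "p \<in> polys q" "\<forall>x\<in>K \<inter> \<Omega>. u x = p x" "r \<in> polys q" "\<forall>x\<in>K \<inter> \<Omega>. v x = r x"
      using assms \<open>K \<in> \<T>\<close> unfolding fe_space_def by blast
    then show ?thesis using polys_lincomb[of p q r a b] by (intro bexI[of _ "\<lambda>x. a * p x + b * r x"]) auto
  qed
  moreover have "continuous_on \<Omega> (\<lambda>x. a * u x + b * v x)"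
    using assms by (auto simp: fe_space_def intro!: continuous_intros)
  ultimately show ?thesis by (simp add: fe_space_def)
qed

lemma fe_space_poly:
  "v \<in> fe_space \<Omega> \<T> q \<Longrightarrow> K \<in> \<T> \<Longrightarrow> \<exists>p\<in>polys q. \<forall>x\<in>K \<inter> \<Omega>. v x = p x"
  by (simp add: fe_space_def)

lemma conforming_mesh_cell:
  assumes "conforming_mesh \<Omega> \<T>" "K \<in> \<T>"
  shows "convex K" "compact K"
proof -
  obtain n where "n simplex K" using assms by (auto simp: conforming_mesh_def)
  then show "convex K" "compact K" by (auto simp: simplex finite_imp_compact_convex_hull)
qed

lemma conforming_mesh_covers: "conforming_mesh \<Omega> \<T> \<Longrightarrow> \<Omega> \<subseteq> \<Union>\<T>"
  using closure_subset[of \<Omega>] by (simp add: conforming_mesh_def)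

lemma fe_space_bounded:
  assumes mesh: "conforming_mesh \<Omega> \<T>" and v: "v \<in> fe_space \<Omega> \<T> q"
  obtains B where "\<And>x. x \<in> \<Omega> \<Longrightarrow> \<bar>v x\<bar> \<le> B"
proof -
  have fin: "finite \<T>" using mesh by (simp add: conforming_mesh_def triangulation_def)
  have "\<exists>B\<ge>0. \<forall>x\<in>K \<inter> \<Omega>. \<bar>v x\<bar> \<le> B" if K: "K \<in> \<T>" for K
  proof -
    have "compact K" using mesh K by (rule conforming_mesh_cell)
    obtain p where p: "p \<in> polys q" "\<forall>x\<in>K \<inter> \<Omega>. v x = p x"
      using fe_space_poly[OF v K] by blast
    obtain L where L: "L-lipschitz_on K p" using polys_lipschitz_on[OF \<open>compact K\<close> p(1)] by blast
    show ?thesis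
      by (rule compact_lipschitz_on_bounded[OF \<open>compact K\<close> L]) (use p(2) in auto)
  qed
  then obtain B where B: "\<And>K. K \<in> \<T> \<Longrightarrow> B K \<ge> 0" "\<And>K x. K \<in> \<T> \<Longrightarrow> x \<in> K \<inter> \<Omega> \<Longrightarrow> \<bar>v x\<bar> \<le> B K"
    by metis
  show ?thesis
  \<comment> \<open>The sum of the nonnegative cell bounds dominates each of them.\<close>
  proof (rule that[of "\<Sum>K\<in>\<T>. B K"])
    fix x assume x: "x \<in> \<Omega>"
    then obtain K where K: "K \<in> \<T>" "x \<in> K"
      using conforming_mesh_covers[OF mesh] by blast
    then have "\<bar>v x\<bar> \<le> B K" using B x by auto
    also have "B K \<le> (\<Sum>K\<in>\<T>. B K)" using fin K B by (intro member_le_sum) auto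
    finally show "\<bar>v x\<bar> \<le> (\<Sum>K\<in>\<T>. B K)" .
  qed
qed

text \<open>Along a segment the cells pull back to finitely many closed sets covering [0, 1]; a
  function that is Lipschitz on each piece is Lipschitz on the interval with the same constant. The
  estimate is confined to segments in \<Omega> because \<Omega> need not be convex.\<close>

lemma fe_space_Lipschitz_on_segments:
  assumes mesh: "conforming_mesh \<Omega> \<T>" and v: "v \<in> fe_space \<Omega> \<T> q"
  obtains L where "\<And>x y. closed_segment x y \<subseteq> \<Omega> \<Longrightarrow> \<bar>v x - v y\<bar> \<le> L * norm (x - y)"
proof -
  have fin: "finite \<T>" using mesh by (simp add: conforming_mesh_def triangulation_def)
  have compact: "compact K" if "K \<in> \<T>" for K
    using mesh that by (rule conforming_mesh_cell)
  have "\<exists>L. L-lipschitz_on (K \<inter> \<Omega>) v" if K: "K \<in> \<T>" for K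
  proof -
    obtain p where p: "p \<in> polys q" "\<forall>x\<in>K \<inter> \<Omega>. v x = p x"
      using fe_space_poly[OF v K] by blast
    obtain L where "L-lipschitz_on K p" using polys_lipschitz_on[OF compact[OF K] p(1)] by blast
    then have "L-lipschitz_on (K \<inter> \<Omega>) p" by (rule lipschitz_on_subset) auto
    then show ?thesis using p(2) by (auto intro: lipschitz_on_transform)
  qed
  then obtain L where L: "\<And>K. K \<in> \<T> \<Longrightarrow> (L K)-lipschitz_on (K \<inter> \<Omega>) v" by metis
  define M where "M = (\<Sum>K\<in>\<T>. L K)"
  have LM: "L K \<le> M" if "K \<in> \<T>" for K
    unfolding M_def using fin that lipschitz_on_nonneg[OF L] by (intro member_le_sum) auto
  have M: "M \<ge> 0" unfolding M_def using lipschitz_on_nonneg[OF L] by (intro sum_nonneg) auto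
  show ?thesis
  proof (rule that[of M])
    fix x y assume seg: "closed_segment x y \<subseteq> \<Omega>"
    define \<gamma> where "\<gamma> t = (1 - t) *\<^sub>R x + t *\<^sub>R y" for t
    have \<gamma>: "\<gamma> t \<in> \<Omega>" if "t \<in> {0..1}" for t
      using seg that by (auto simp: \<gamma>_def closed_segment_def)
    have \<gamma>_cont: "continuous_on A \<gamma>" for A
      unfolding \<gamma>_def by (intro continuous_intros)
    have \<gamma>_dist: "dist (\<gamma> s) (\<gamma> t) = norm (x - y) * dist s t" for s t
    proof -
      have "\<gamma> s - \<gamma> t = (t - s) *\<^sub>R (x - y)" by (simp add: \<gamma>_def algebra_simps)
      then show ?thesis by (simp add: dist_norm abs_minus_commute)
    qed
    have "(M * norm (x - y))-lipschitz_on {0..1} (\<lambda>t. v (\<gamma> t))"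
    proof (rule lipschitz_on_closed_Union[where I = \<T> and U = "\<lambda>K. {0..1} \<inter> \<gamma> -` K"])
      fix K assume K: "K \<in> \<T>"
      show "(M * norm (x - y))-lipschitz_on ({0..1} \<inter> \<gamma> -` K) (\<lambda>t. v (\<gamma> t))"
      proof (rule lipschitz_onI)
        fix s t assume st: "s \<in> {0..1} \<inter> \<gamma> -` K" "t \<in> {0..1} \<inter> \<gamma> -` K"
        then have "dist (v (\<gamma> s)) (v (\<gamma> t)) \<le> L K * dist (\<gamma> s) (\<gamma> t)"
          using \<gamma> by (intro lipschitz_onD[OF L[OF K]]) auto
        also have "\<dots> \<le> M * dist (\<gamma> s) (\<gamma> t)" using LM[OF K] by (intro mult_right_mono) auto
        finally show "dist (v (\<gamma> s)) (v (\<gamma> t)) \<le> M * norm (x - y) * dist s t"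
          by (simp add: \<gamma>_dist mult.assoc)
      qed (use M in simp)
      show "closed ({0..1} \<inter> \<gamma> -` K)"
        using \<gamma>_cont compact_imp_closed[OF compact[OF K]] by (intro continuous_closed_preimage) auto
    next
      show "{0..1} \<subseteq> (\<Union>K\<in>\<T>. {0..1} \<inter> \<gamma> -` K)"
        using \<gamma> conforming_mesh_covers[OF mesh] by blast
    qed (use fin M in auto)
    \<comment> \<open>The parameters 0 and 1 are the endpoints \<open>x\<close> and
      \<open>y\<close>, and the length of the segment is already part of the constant.\<close>
    from lipschitz_onD[OF this, of 0 1] show "\<bar>v x - v y\<bar> \<le> M * norm (x - y)"
      by (simp add: \<gamma>_def dist_real_def)
  qed
qed

text \<open>Cells are convex, so their finitely many frontiers form a null set; any other point of
  \<Omega> has a neighbourhood on which \<open>v\<close> is a polynomial.\<close>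

lemma fe_space_AE_differentiable:
  fixes \<Omega> :: "(real ^ 'd) set"
  assumes "open \<Omega>" and mesh: "conforming_mesh \<Omega> \<T>" and v: "v \<in> fe_space \<Omega> \<T> q"
  shows "AE x in lebesgue. x \<in> \<Omega> \<longrightarrow> v differentiable (at x)"
proof -
  have fin: "finite \<T>" using mesh by (simp add: conforming_mesh_def triangulation_def)
  have "negligible (frontier K)" if "K \<in> \<T>" for K
    using conforming_mesh_cell[OF mesh that] by (intro negligible_convex_frontier)
  then have "negligible (\<Union>K\<in>\<T>. frontier K)" using fin by (intro negligible_Union) auto
  then have "AE x in lebesgue. x \<notin> (\<Union>K\<in>\<T>. frontier K)"
    by (intro AE_not_in) (simp add: negligible_iff_null_sets)
  then show ?thesis
  proof eventually_elim
    case (elim x)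
    show ?case
    proof
      assume x: "x \<in> \<Omega>"
      then obtain K where K: "K \<in> \<T>" "x \<in> K"
        using conforming_mesh_covers[OF mesh] by blast
      then have int: "x \<in> interior K"
        using elim closure_subset by (auto simp: frontier_def)
      obtain p where p: "p \<in> polys q" "\<forall>x\<in>K \<inter> \<Omega>. v x = p x"
        using fe_space_poly[OF v K(1)] by blast
      obtain F where F: "(p has_derivative F) (at x)"
        using polys_differentiable[OF p(1)] by (auto simp: differentiable_def)
      have "(v has_derivative F) (at x)"
        by (rule has_derivative_transform_within_open[OF F, of "interior K \<inter> \<Omega>"])
           (use \<open>open \<Omega>\<close> int x p(2) in \<open>auto dest: subsetD[OF interior_subset]\<close>)
      then show "v differentiable (at x)" by (auto simp: differentiable_def)
    qed
  qed
qed

lemma fe_space_subset_H1: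
  assumes "open \<Omega>" "bounded \<Omega>" "conforming_mesh \<Omega> \<T>" "v \<in> fe_space \<Omega> \<T> q"
  shows "v \<in> H1 \<Omega>"
proof -
  obtain B where B: "\<And>x. x \<in> \<Omega> \<Longrightarrow> \<bar>v x\<bar> \<le> B" using fe_space_bounded assms by blast
  obtain L where L: "\<And>x y. closed_segment x y \<subseteq> \<Omega> \<Longrightarrow> \<bar>v x - v y\<bar> \<le> L * norm (x - y)"
    using fe_space_Lipschitz_on_segments assms by blast
  show ?thesis
    using assms fe_space_AE_differentiable
    by (intro H1_if_Lipschitz_on_segments[OF assms(1,2) _ B L]) (auto simp: fe_space_def)
qed

subsection \<open>The energy identity\<close>

lemma L2_norm_power2: "(L2_norm \<Omega> u)\<^sup>2 = (LINT x|lebesgue_on \<Omega>. (norm (u x))\<^sup>2)"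
proof -
  have "L2_inner \<Omega> u u = (LINT x|lebesgue_on \<Omega>. (norm (u x))\<^sup>2)"
    by (simp add: L2_inner_def power2_norm_eq_inner)
  then show ?thesis by (simp add: L2_norm_def)
qed

lemma L2_norm_power2_integrable:
  "u \<in> L2 \<Omega> \<Longrightarrow> integrable (lebesgue_on \<Omega>) (\<lambda>x. (norm (u x))\<^sup>2)"
  by (simp add: L2_def)

text \<open>Allows explicit combinations of gradients in place of the arbitrary choice
  \<open>weak_grad\<close>; \<open>L2\<close> membership supplies the measurability.\<close>

lemma grad_form_cong_AE:
  assumes "AE x in lebesgue_on \<Omega>. weak_grad \<Omega> u x = g x" "AE x in lebesgue_on \<Omega>. weak_grad \<Omega> v x = h x"
    and "weak_grad \<Omega> u \<in> L2 \<Omega>" "weak_grad \<Omega> v \<in> L2 \<Omega>" "g \<in> L2 \<Omega>" "h \<in> L2 \<Omega>"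
  shows "grad_form \<Omega> u v = L2_inner \<Omega> g h"
  unfolding grad_form_def L2_inner_def
proof (rule integral_cong_AE)
  show "AE x in lebesgue_on \<Omega>. weak_grad \<Omega> u x \<bullet> weak_grad \<Omega> v x = g x \<bullet> h x"
    using assms(1,2) by eventually_elim simp
qed (use assms in \<open>auto simp: L2_def\<close>)

text \<open>\<open>L2\<close> is not closed under products, whereas the scheme and the energy
  involve quartic terms. This class is an algebra, and its members are integrable on a bounded open
  set.\<close>

definition bdd_measurable :: "(real ^ 'd) set \<Rightarrow> (real ^ 'd \<Rightarrow> real) \<Rightarrow> bool" where
  "bdd_measurable \<Omega> f \<longleftrightarrow>
     f \<in> borel_measurable (lebesgue_on \<Omega>) \<and> (\<exists>B. \<forall>x\<in>\<Omega>. \<bar>f x\<bar> \<le> B)"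

lemma bdd_measurable_const: "bdd_measurable \<Omega> (\<lambda>x. c)"
  by (auto simp: bdd_measurable_def)

lemma bdd_measurable_add:
  assumes "bdd_measurable \<Omega> f" "bdd_measurable \<Omega> g"
  shows "bdd_measurable \<Omega> (\<lambda>x. f x + g x)"
proof -
  obtain A B where "\<forall>x\<in>\<Omega>. \<bar>f x\<bar> \<le> A" "\<forall>x\<in>\<Omega>. \<bar>g x\<bar> \<le> B"
    using assms by (auto simp: bdd_measurable_def)
  then have "\<forall>x\<in>\<Omega>. \<bar>f x + g x\<bar> \<le> A + B" by fastforce
  moreover have "(\<lambda>x. f x + g x) \<in> borel_measurable (lebesgue_on \<Omega>)"
    using assms by (auto simp: bdd_measurable_def)
  ultimately show ?thesis unfolding bdd_measurable_def by blast
qed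

lemma bdd_measurable_mult:
  assumes "bdd_measurable \<Omega> f" "bdd_measurable \<Omega> g"
  shows "bdd_measurable \<Omega> (\<lambda>x. f x * g x)"
proof -
  obtain A B where "\<forall>x\<in>\<Omega>. \<bar>f x\<bar> \<le> A" "\<forall>x\<in>\<Omega>. \<bar>g x\<bar> \<le> B"
    using assms by (auto simp: bdd_measurable_def)
  then have "\<forall>x\<in>\<Omega>. \<bar>f x * g x\<bar> \<le> A * B"
    unfolding abs_mult by (meson abs_ge_zero mult_mono order_trans)
  moreover have "(\<lambda>x. f x * g x) \<in> borel_measurable (lebesgue_on \<Omega>)"
    using assms by (auto simp: bdd_measurable_def)
  ultimately show ?thesis unfolding bdd_measurable_def by blast
qed

lemma bdd_measurable_diff:
  assumes "bdd_measurable \<Omega> f" "bdd_measurable \<Omega> g"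
  shows "bdd_measurable \<Omega> (\<lambda>x. f x - g x)"
  using bdd_measurable_add[OF assms(1) bdd_measurable_mult[OF bdd_measurable_const[of \<Omega> "- 1"] assms(2)]]
  by simp

lemma bdd_measurable_power:
  "bdd_measurable \<Omega> f \<Longrightarrow> bdd_measurable \<Omega> (\<lambda>x. f x ^ n)"
  by (induction n) (auto intro: bdd_measurable_const bdd_measurable_mult)

lemmas bdd_measurable_intros =
  bdd_measurable_const bdd_measurable_add bdd_measurable_diff bdd_measurable_mult bdd_measurable_power

lemma bdd_measurable_integrable:
  assumes "open \<Omega>" "bounded \<Omega>" "bdd_measurable \<Omega> f"
  shows "integrable (lebesgue_on \<Omega>) f"
proof -
  interpret finite_measure "lebesgue_on \<Omega>"
    using finite_measure_lebesgue_on_bounded_open assms by blast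
  obtain B where "\<forall>x\<in>\<Omega>. \<bar>f x\<bar> \<le> B" using assms by (auto simp: bdd_measurable_def)
  then show ?thesis
    using assms by (intro integrable_const_bound[where B = B] AE_I2) (auto simp: bdd_measurable_def space_restrict_space)
qed

text \<open>The integral may be split because the double well is bounded and the gradient is square
  integrable.\<close>

lemma energy_eq:
  assumes "open \<Omega>" "bounded \<Omega>" "bdd_measurable \<Omega> a" "weak_grad \<Omega> a \<in> L2 \<Omega>"
  shows "energy \<Omega> \<epsilon> a = 1 / (4 * \<epsilon>) * (LINT x|lebesgue_on \<Omega>. ((a x)\<^sup>2 - 1)\<^sup>2)
      + \<epsilon> / 2 * (LINT x|lebesgue_on \<Omega>. (norm (weak_grad \<Omega> a x))\<^sup>2)"
proof -
  have "integrable (lebesgue_on \<Omega>) (\<lambda>x. ((a x)\<^sup>2 - 1)\<^sup>2)"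
    using assms by (intro bdd_measurable_integrable bdd_measurable_intros)
  then show ?thesis
    using L2_norm_power2_integrable[OF assms(4)] unfolding energy_def by simp
qed

text \<open>\<open>chi a b * (a - b)\<close> is exactly \<open>(a ^ 4 - b ^ 4) / 4\<close>. The
  extrapolation equals the mean of \<open>a\<close> and \<open>b\<close> minus half the second
  difference \<open>a - 2 * b + c\<close>; the mean completes the double well, and the second
  difference gives the remaining squares.\<close>

lemma nonlinear_term_identity:
  "(LINT x|lebesgue_on \<Omega>. chi (a x) (b x) * (a x - b x))
     - (LINT x|lebesgue_on \<Omega>. (3/2 * b x - 1/2 * c x) * (a x - b x))
   = 1/4 * (LINT x|lebesgue_on \<Omega>. ((a x)\<^sup>2 - 1)\<^sup>2) - 1/4 * (LINT x|lebesgue_on \<Omega>. ((b x)\<^sup>2 - 1)\<^sup>2)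
     + 1/4 * (L2_norm \<Omega> (\<lambda>x. a x - b x))\<^sup>2 - 1/4 * (L2_norm \<Omega> (\<lambda>x. b x - c x))\<^sup>2
     + 1/4 * (L2_norm \<Omega> (\<lambda>x. a x - 2 * b x + c x))\<^sup>2"
  if "open \<Omega>" "bounded \<Omega>" "bdd_measurable \<Omega> a" "bdd_measurable \<Omega> b" "bdd_measurable \<Omega> c"
proof -
  note int = bdd_measurable_integrable[OF that(1,2)] bdd_measurable_intros that
  have int_lhs: "integrable (lebesgue_on \<Omega>) (\<lambda>x. chi (a x) (b x) * (a x - b x))"
    "integrable (lebesgue_on \<Omega>) (\<lambda>x. (3/2 * b x - 1/2 * c x) * (a x - b x))"
    unfolding chi_def by (intro int)+
  have [simp]: "integrable (lebesgue_on \<Omega>) (\<lambda>x. ((a x)\<^sup>2 - 1)\<^sup>2)"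
    "integrable (lebesgue_on \<Omega>) (\<lambda>x. ((b x)\<^sup>2 - 1)\<^sup>2)"
    "integrable (lebesgue_on \<Omega>) (\<lambda>x. (a x - b x)\<^sup>2)"
    "integrable (lebesgue_on \<Omega>) (\<lambda>x. (b x - c x)\<^sup>2)"
    "integrable (lebesgue_on \<Omega>) (\<lambda>x. (a x - 2 * b x + c x)\<^sup>2)"
    by (intro int)+
  have "(LINT x|lebesgue_on \<Omega>. chi (a x) (b x) * (a x - b x))
      - (LINT x|lebesgue_on \<Omega>. (3/2 * b x - 1/2 * c x) * (a x - b x))
      = (LINT x|lebesgue_on \<Omega>. chi (a x) (b x) * (a x - b x) - (3/2 * b x - 1/2 * c x) * (a x - b x))"
    by (intro Bochner_Integration.integral_diff[symmetric] int_lhs)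
  also have "\<dots> = (LINT x|lebesgue_on \<Omega>. 1/4 * ((a x)\<^sup>2 - 1)\<^sup>2 - 1/4 * ((b x)\<^sup>2 - 1)\<^sup>2
      + 1/4 * (a x - b x)\<^sup>2 - 1/4 * (b x - c x)\<^sup>2 + 1/4 * (a x - 2 * b x + c x)\<^sup>2)"
    by (intro Bochner_Integration.integral_cong) (auto simp: chi_def field_simps power2_eq_square)
  also have "\<dots> = 1/4 * (LINT x|lebesgue_on \<Omega>. ((a x)\<^sup>2 - 1)\<^sup>2) - 1/4 * (LINT x|lebesgue_on \<Omega>. ((b x)\<^sup>2 - 1)\<^sup>2)
     + 1/4 * (LINT x|lebesgue_on \<Omega>. (a x - b x)\<^sup>2) - 1/4 * (LINT x|lebesgue_on \<Omega>. (b x - c x)\<^sup>2)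
     + 1/4 * (LINT x|lebesgue_on \<Omega>. (a x - 2 * b x + c x)\<^sup>2)"
    by simp
  finally show ?thesis by (simp add: L2_norm_power2)
qed

text \<open>The weighted average is (u + v)/2 + (u - 2v + w)/4. Against u - v, the first part gives
  half the difference of squares; the second is polarized using u - 2v + w = (u - v) - (v -
  w).\<close>

lemma gradient_term_identity:
  assumes "ga \<in> L2 \<Omega>" "gb \<in> L2 \<Omega>" "gc \<in> L2 \<Omega>"
  shows "L2_inner \<Omega> (\<lambda>x. (3/4) *\<^sub>R ga x + (1/4) *\<^sub>R gc x) (\<lambda>x. ga x - gb x)
   = 1/2 * (L2_norm \<Omega> ga)\<^sup>2 - 1/2 * (L2_norm \<Omega> gb)\<^sup>2
     + 1/8 * (L2_norm \<Omega> (\<lambda>x. ga x - gb x))\<^sup>2 - 1/8 * (L2_norm \<Omega> (\<lambda>x. gb x - gc x))\<^sup>2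
     + 1/8 * (L2_norm \<Omega> (\<lambda>x. ga x - 2 *\<^sub>R gb x + gc x))\<^sup>2"
proof -
  have diff: "(\<lambda>x. u x - v x) \<in> L2 \<Omega>" if "u \<in> L2 \<Omega>" "v \<in> L2 \<Omega>" for u v :: "real ^ 'a \<Rightarrow> 'b"
    using L2_lincomb[OF that, of 1 "-1"] by simp
  have "(\<lambda>x. ga x - 2 *\<^sub>R gb x + gc x) \<in> L2 \<Omega>"
    using L2_lincomb[OF L2_lincomb[OF assms(1,2), of 1 "-2"] assms(3), of 1 1] by simp
  note [simp] = assms[THEN L2_norm_power2_integrable] this[THEN L2_norm_power2_integrable]
    diff[OF assms(1,2), THEN L2_norm_power2_integrable] diff[OF assms(2,3), THEN L2_norm_power2_integrable]
  have "((3/4) *\<^sub>R u + (1/4) *\<^sub>R w) \<bullet> (u - v)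
      = 1/2 * (norm u)\<^sup>2 - 1/2 * (norm v)\<^sup>2 + 1/8 * (norm (u - v))\<^sup>2 - 1/8 * (norm (v - w))\<^sup>2
        + 1/8 * (norm (u - 2 *\<^sub>R v + w))\<^sup>2" for u v w :: 'b
    unfolding power2_norm_eq_inner inner_add_left inner_add_right inner_diff_left inner_diff_right
      inner_scaleR_left inner_scaleR_right inner_commute[of v u] inner_commute[of w u] inner_commute[of w v]
    by (simp add: field_simps)
  then show ?thesis by (simp add: L2_inner_def L2_norm_power2)
qed

text \<open>The energy law for one time step. The finite element space enters only through inclusion
  in \<open>H1\<close>, bounded measurability and closure under linear combinations.\<close>

lemma multistep_energy_identity:
  fixes S :: "(real ^ 'd \<Rightarrow> real) set"
  assumes \<Omega>: "open \<Omega>" "bounded \<Omega>"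
    and H1: "\<And>v. v \<in> S \<Longrightarrow> v \<in> H1 \<Omega>"
    and bdd: "\<And>v. v \<in> S \<Longrightarrow> bdd_measurable \<Omega> v"
    and lincomb: "\<And>u v r s. u \<in> S \<Longrightarrow> v \<in> S \<Longrightarrow> (\<lambda>x. r * u x + s * v x) \<in> S"
    and pos: "\<epsilon> > 0" "\<tau> > 0"
    and mem: "b \<in> S" "c \<in> S"
    and step: "multistep \<Omega> S \<epsilon> \<tau> c b a \<mu>"
  shows "modified_energy \<Omega> \<epsilon> a b + (\<tau> * \<epsilon> * (L2_norm \<Omega> (weak_grad \<Omega> \<mu>))\<^sup>2
     + (1 / (4 * \<epsilon>) * (L2_norm \<Omega> (\<lambda>x. a x - 2 * b x + c x))\<^sup>2
        + \<epsilon> / 8 * (L2_norm \<Omega> (\<lambda>x. weak_grad \<Omega> a x - 2 *\<^sub>R weak_grad \<Omega> b x + weak_grad \<Omega> c x))\<^sup>2))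
     = modified_energy \<Omega> \<epsilon> b c"
proof -
  \<comment> \<open>The increment is spelled as a linear combination so that \<open>lincomb\<close>
    and \<open>H1_lincomb\<close> match it.\<close>
  let ?\<delta> = "\<lambda>x. 1 * a x + (- 1) * b x"
  let ?w = "\<lambda>x. 3/4 * a x + 1/4 * c x"
  let ?g = "weak_grad \<Omega>"
  have a: "a \<in> S" and \<mu>: "\<mu> \<in> S" using step by (auto simp: multistep_def)
  have \<delta>: "?\<delta> \<in> S" and w: "?w \<in> S" using lincomb a mem by blast+
  have g: "?g v \<in> L2 \<Omega>" if "v \<in> S" for v using weak_grad_H1(1) H1 that by blast
  have eq1: "L2_inner \<Omega> (\<lambda>x. (a x - b x) / \<tau>) \<mu> + \<epsilon> * grad_form \<Omega> \<mu> \<mu> = 0"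
    and eq2: "inverse \<epsilon> * L2_inner \<Omega> (\<lambda>x. chi (a x) (b x)) ?\<delta>
        - inverse \<epsilon> * L2_inner \<Omega> (\<lambda>x. 3/2 * b x - 1/2 * c x) ?\<delta>
        + \<epsilon> * grad_form \<Omega> ?w ?\<delta> - L2_inner \<Omega> \<mu> ?\<delta> = 0"
    using step \<mu> \<delta> unfolding multistep_def by blast+
  have "L2_inner \<Omega> (\<lambda>x. (a x - b x) / \<tau>) \<mu> = L2_inner \<Omega> \<mu> ?\<delta> / \<tau>"
    by (simp add: L2_inner_def mult.commute)
  moreover have "grad_form \<Omega> \<mu> \<mu> = (L2_norm \<Omega> (?g \<mu>))\<^sup>2"
    by (simp add: grad_form_def L2_inner_def L2_norm_power2 power2_norm_eq_inner)
  ultimately have "L2_inner \<Omega> \<mu> ?\<delta> / \<tau> + \<epsilon> * (L2_norm \<Omega> (?g \<mu>))\<^sup>2 = 0"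
    using eq1 by (simp only:)
  \<comment> \<open>The first equation turns the coupling term of the second into the
    dissipation.\<close>
  then have \<mu>_eq: "L2_inner \<Omega> \<mu> ?\<delta> = - (\<tau> * \<epsilon> * (L2_norm \<Omega> (?g \<mu>))\<^sup>2)"
    using pos(2) by (simp add: field_simps add_eq_0_iff)
  have "AE x in lebesgue_on \<Omega>. ?g ?\<delta> x = ?g a x - ?g b x"
    using H1_lincomb(2)[OF \<Omega> H1[OF a] H1[OF mem(1)], of 1 "-1"] by simp
  moreover have "(\<lambda>x. ?g a x - ?g b x) \<in> L2 \<Omega>"
    using L2_lincomb[OF g[OF a] g[OF mem(1)], of 1 "-1"] by simp
  ultimately have "grad_form \<Omega> ?w ?\<delta>
      = L2_inner \<Omega> (\<lambda>x. (3/4) *\<^sub>R ?g a x + (1/4) *\<^sub>R ?g c x) (\<lambda>x. ?g a x - ?g b x)"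
    using H1_lincomb(2)[OF \<Omega> H1[OF a] H1[OF mem(2)], of "3/4" "1/4"] g[OF w] g[OF \<delta>]
      L2_lincomb[OF g[OF a] g[OF mem(2)], of "3/4" "1/4"]
    by (intro grad_form_cong_AE)
  note grad = this[unfolded gradient_term_identity[OF g[OF a] g[OF mem(1)] g[OF mem(2)]]]
  have "L2_inner \<Omega> (\<lambda>x. chi (a x) (b x)) ?\<delta> - L2_inner \<Omega> (\<lambda>x. 3/2 * b x - 1/2 * c x) ?\<delta>
      = (LINT x|lebesgue_on \<Omega>. chi (a x) (b x) * (a x - b x))
       - (LINT x|lebesgue_on \<Omega>. (3/2 * b x - 1/2 * c x) * (a x - b x))"
    by (simp add: L2_inner_def)
  note nonlin = this[unfolded nonlinear_term_identity[OF \<Omega> bdd[OF a] bdd[OF mem(1)] bdd[OF mem(2)]]]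
  have eq3: "inverse \<epsilon> * (L2_inner \<Omega> (\<lambda>x. chi (a x) (b x)) ?\<delta> - L2_inner \<Omega> (\<lambda>x. 3/2 * b x - 1/2 * c x) ?\<delta>)
        + \<epsilon> * grad_form \<Omega> ?w ?\<delta> - L2_inner \<Omega> \<mu> ?\<delta> = 0"
    using eq2 by (simp only: right_diff_distrib)
  \<comment> \<open>With this rewriting all terms share the factor
    \<open>inverse \<epsilon>\<close>, and what remains is linear rearrangement.\<close>
  have coeff: "1 / (4 * \<epsilon>) = inverse \<epsilon> * (1/4)" by (simp add: field_simps)
  show ?thesis
    using eq3[unfolded nonlin grad \<mu>_eq] pos(1)
    unfolding modified_energy_def energy_eq[OF \<Omega> bdd[OF a] g[OF a]]
      energy_eq[OF \<Omega> bdd[OF mem(1)] g[OF mem(1)]] L2_norm_power2[of \<Omega> "?g a", symmetric]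
      L2_norm_power2[of \<Omega> "?g b", symmetric]
      coeff
    by (simp add: algebra_simps)
qed

lemma sum_telescope_from_one:
  fixes F d :: "nat \<Rightarrow> real"
  assumes "\<And>m. 1 \<le> m \<Longrightarrow> m \<le> l \<Longrightarrow> F (m + 1) + d m = F m"
  shows "F (l + 1) + (\<Sum>m = 1..l. d m) = F 1"
  using assms
proof (induction l)
  case (Suc l)
  have "F (Suc l + 1) + d (Suc l) = F (Suc l)" using Suc.prems by simp
  moreover have "F (l + 1) + (\<Sum>m = 1..l. d m) = F 1" using Suc by simp
  ultimately show ?case by simp
qed simp

(* \<phi> m is \<phi>_h^m, \<mu> m is \<mu>_h^{m+1/2}, and \<mu>\<^sub>h0 is \<mu>_h^0. *)
theorem lemma2p5:
  fixes \<Omega> :: "(real ^ 'd) set"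
    and H :: "real set" and \<T> :: "real \<Rightarrow> (real ^ 'd) set set"
    and q M :: nat and \<epsilon> T \<tau> h :: real
    and \<phi>\<^sub>0 \<mu>\<^sub>0 \<mu>\<^sub>h\<^sub>0 :: "real ^ 'd \<Rightarrow> real"
    and \<phi> \<mu> :: "nat \<Rightarrow> real ^ 'd \<Rightarrow> real"
    and S :: "(real ^ 'd \<Rightarrow> real) set"
  assumes "CARD('d) = 2 \<or> CARD('d) = 3"
    and "polyhedral_domain \<Omega>"
    and "mesh_family \<Omega> H \<T>" and "h \<in> H"
    and "q \<ge> 1" and "S = fe_space \<Omega> (\<T> h) q"
    and "\<epsilon> > 0" and "T > 0" and "M > 0" and "\<tau> = T / real M"
    and "\<phi>\<^sub>0 \<in> H2 \<Omega>" and "zero_normal_deriv \<Omega> \<phi>\<^sub>0"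
    and "\<mu>\<^sub>0 = initial_potential \<Omega> \<epsilon> \<phi>\<^sub>0" and "\<mu>\<^sub>0 \<in> H1 \<Omega>"
    and "is_ritz_projection \<Omega> S \<phi>\<^sub>0 (\<phi> 0)"
    and "is_ritz_projection \<Omega> S \<mu>\<^sub>0 \<mu>\<^sub>h\<^sub>0"
    and "first_step \<Omega> S \<epsilon> \<tau> (\<phi> 0) \<mu>\<^sub>h\<^sub>0 (\<phi> 1) (\<mu> 0)"
    and "\<And>m. 1 \<le> m \<Longrightarrow> m \<le> M - 1 \<Longrightarrow>
           multistep \<Omega> S \<epsilon> \<tau> (\<phi> (m - 1)) (\<phi> m) (\<phi> (m + 1)) (\<mu> m)"
  shows "\<forall>l. 1 \<le> l \<and> l \<le> M - 1 \<longrightarrow>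
    modified_energy \<Omega> \<epsilon> (\<phi> (l + 1)) (\<phi> l)
    + \<tau> * \<epsilon> * (\<Sum>m = 1..l. (L2_norm \<Omega> (weak_grad \<Omega> (\<mu> m)))\<^sup>2)
    + (\<Sum>m = 1..l.
         1 / (4 * \<epsilon>) * (L2_norm \<Omega> (\<lambda>x. \<phi> (m + 1) x - 2 * \<phi> m x + \<phi> (m - 1) x))\<^sup>2
         + \<epsilon> / 8 * (L2_norm \<Omega> (\<lambda>x. weak_grad \<Omega> (\<phi> (m + 1)) x - 2 *\<^sub>R weak_grad \<Omega> (\<phi> m) x
                                 + weak_grad \<Omega> (\<phi> (m - 1)) x))\<^sup>2)
    = modified_energy \<Omega> \<epsilon> (\<phi> 1) (\<phi> 0)"
proof (intro allI impI)
  fix l assume l: "1 \<le> l \<and> l \<le> M - 1"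
  have \<Omega>: "open \<Omega>" "bounded \<Omega>" using assms(2) by (auto simp: polyhedral_domain_def)
  have mesh: "conforming_mesh \<Omega> (\<T> h)" using assms(3,4) by (auto simp: mesh_family_def)
  have H1: "v \<in> H1 \<Omega>" if "v \<in> S" for v
    using fe_space_subset_H1[OF \<Omega> mesh] that assms(6) by blast
  have bdd: "bdd_measurable \<Omega> v" if "v \<in> S" for v
  proof -
    obtain B where "\<And>x. x \<in> \<Omega> \<Longrightarrow> \<bar>v x\<bar> \<le> B"
      using fe_space_bounded[OF mesh] \<open>v \<in> S\<close> assms(6) by blast
    then show ?thesis using H1[OF that] by (auto simp: bdd_measurable_def H1_def L2_def)
  qed
  have lincomb: "(\<lambda>x. r * u x + s * v x) \<in> S" if "u \<in> S" "v \<in> S" for u v r s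
    using fe_space_lincomb that assms(6) by blast
  have "\<tau> > 0" using assms(8-10) by simp
  \<comment> \<open>Index 0 comes from the Ritz projection, index 1 from the first step, and each
    later \<open>m\<close> from the multistep problem at \<open>m - 1\<close>.\<close>
  have mem: "\<phi> m \<in> S" if "m \<le> M" for m
  proof (cases "m \<le> 1")
    case True
    then consider "m = 0" | "m = 1" by linarith
    then show ?thesis using assms(15,17) by cases (auto simp: is_ritz_projection_def first_step_def)
  next
    case False
    then show ?thesis using assms(18)[of "m - 1"] that by (auto simp: multistep_def)
  qed
  \<comment> \<open>Telescoping starts at 1, so the truncated difference \<open>0 - 1\<close> never
    occurs; \<open>F 1\<close> is the initial modified energy.\<close>
  define F where "F m = modified_energy \<Omega> \<epsilon> (\<phi> m) (\<phi> (m - 1))" for m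
  define d where "d m = \<tau> * \<epsilon> * (L2_norm \<Omega> (weak_grad \<Omega> (\<mu> m)))\<^sup>2
      + (1 / (4 * \<epsilon>) * (L2_norm \<Omega> (\<lambda>x. \<phi> (m + 1) x - 2 * \<phi> m x + \<phi> (m - 1) x))\<^sup>2
         + \<epsilon> / 8 * (L2_norm \<Omega> (\<lambda>x. weak_grad \<Omega> (\<phi> (m + 1)) x - 2 *\<^sub>R weak_grad \<Omega> (\<phi> m) x
                                 + weak_grad \<Omega> (\<phi> (m - 1)) x))\<^sup>2)" for m
  have "F (l + 1) + (\<Sum>m = 1..l. d m) = F 1"
  proof (rule sum_telescope_from_one)
    fix m assume m: "1 \<le> m" "m \<le> l"
    then have "m \<le> M - 1" "\<phi> m \<in> S" "\<phi> (m - 1) \<in> S" using l by (auto intro: mem)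
    then show "F (m + 1) + d m = F m"
      unfolding F_def d_def add_diff_cancel_right'
      by (intro multistep_energy_identity[OF \<Omega> H1 bdd lincomb assms(7) \<open>\<tau> > 0\<close>] assms(18)[OF m(1)])
  qed
  then show "modified_energy \<Omega> \<epsilon> (\<phi> (l + 1)) (\<phi> l)
    + \<tau> * \<epsilon> * (\<Sum>m = 1..l. (L2_norm \<Omega> (weak_grad \<Omega> (\<mu> m)))\<^sup>2)
    + (\<Sum>m = 1..l.
         1 / (4 * \<epsilon>) * (L2_norm \<Omega> (\<lambda>x. \<phi> (m + 1) x - 2 * \<phi> m x + \<phi> (m - 1) x))\<^sup>2
         + \<epsilon> / 8 * (L2_norm \<Omega> (\<lambda>x. weak_grad \<Omega> (\<phi> (m + 1)) x - 2 *\<^sub>R weak_grad \<Omega> (\<phi> m) x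
                                 + weak_grad \<Omega> (\<phi> (m - 1)) x))\<^sup>2)
    = modified_energy \<Omega> \<epsilon> (\<phi> 1) (\<phi> 0)"
    \<comment> \<open>The fixed first summand splits off only the dissipation and leaves the bracket
      of second differences as one sum.\<close>
    unfolding F_def d_def sum.distrib[of "\<lambda>m. \<tau> * \<epsilon> * (L2_norm \<Omega> (weak_grad \<Omega> (\<mu> m)))\<^sup>2"]
    by (simp add: sum_distrib_left add.assoc)
qed

end
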